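(* Let $f,g\in\mathcal{A}$, let $p,b\in\mathbb{R}$ be such that $\kappa=p+\frac{b+1}{2}>-1$, let $c\in\mathbb{C}$ with $c\neq0$, and let $\lambda\in[0,1)$. Put $$\Phi(z)=(1-\lambda)\frac{B_{\kappa+1,c}(g)(z)}{z}+\lambda\frac{B_{\kappa+2,c}(g)(z)}{z},\qquad z\in\mathbb{D}.$$ Suppose that for all $z\in\mathbb{D}$ $$\operatorname{Re}\left(\frac{z\Phi''(z)}{\Phi'(z)}+1\right)>-\gamma_{\lambda,\kappa},\qquad \gamma_{\lambda,\kappa}=\frac{(1-\lambda)^2+(\kappa+1)^2-\sqrt{(1-\lambda)^4+(\kappa+1)^4}}{4(1-\lambda)(\kappa+1)},$$ and assume that $$z\mapsto(1-\lambda)\frac{B_{\kappa+1,c}(f)(z)}{z}+\lambda\frac{B_{\kappa+2,c}(f)(z)}{z}$$ is univalent in $\mathbb{D}$ and that the function $z\mapsto B_{\kappa+2,c}(f)(z)/z$ belongs to $\mathcal{H}[1,1]\cap Q$. Then the superordination $$(1-\lambda)\frac{B_{\kappa+1,c}(g)(z)}{z}+\lambda\frac{B_{\kappa+2,c}(g)(z)}{z}\prec(1-\lambda)\frac{B_{\kappa+1,c}(f)(z)}{z}+\lambda\frac{B_{\kappa+2,c}(f)(z)}{z}$$ implies that $$\frac{B_{\kappa+2,c}(g)(z)}{z}\prec\frac{B_{\kappa+2,c}(f)(z)}{z}.$$ Moreover, the function $z\mapsto B_{\kappa+2,c}(g)(z)/z$ is the best subordinant of the differential superordination $\Phi(z)\prec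 P(z)+\frac{1-\lambda}{\kappa+1}\,zP'(z)$.
   Context: $\mathbb{D}=\{z\in\mathbb{C}:|z|<1\}$. $\mathcal{A}$ is the class of functions $f(z)=z+\sum_{n\ge1}a_{n+1}z^{n+1}$ that are analytic and univalent (injective) in $\mathbb{D}$. $\mathcal{H}[1,1]$ is the class of analytic functions in $\mathbb{D}$ of the form $1+a_1z+a_2z^2+\dots$. For $\nu\in\mathbb{C}\setminus\{0,-1,-2,\dots\}$ and $c\in\mathbb{C}\setminus\{0\}$, and $f(z)=z+\sum_{n\ge1}a_{n+1}z^{n+1}$ analytic in $\mathbb{D}$, define $$B_{\nu,c}(f)(z)=z+\sum_{n\ge1}a_{n+1}\frac{(-c/4)^n}{(\nu)_n}\frac{z^{n+1}}{n!},\qquad (\nu)_n=\nu(\nu+1)\cdots(\nu+n-1).$$ Expressions such as $B_{\nu,c}(f)(z)/z$ are understood to be extended analytically to $z=0$ (with value $1$). Subordination: for $f,F$ analytic in $\mathbb{D}$, $f\prec F$ ($F$ is superordinate to $f$) means there is $w$ analytic in $\mathbb{D}$ with $|w(z)|\le|z|$ and $f(z)=F(w(z))$ for all $z\in\mathbb{D}$. $Q$ is the class of functions $f$ that are analytic and injective on $\overline{\mathbb{D}}\setminus E(f)$, where $E(f)=\{\zeta\in\partial\mathbb{D}:\lim_{z\to\zeta}f(z)=\infty\}$, and such that $f'(\zeta)\ne0$ for $\zeta\in\partial\mathbb{D}\setminus E(f)$. Best subordinant: let $\varphi:\mathbb{C}^2\to\mathbb{C}$ and let $h$ be analytic in $\mathbb{D}$.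 A solution of the differential superordination $h(z)\prec\varphi(P(z),zP'(z))$ is a function $P$ such that $P$ and $z\mapsto\varphi(P(z),zP'(z))$ are univalent in $\mathbb{D}$ and satisfy it. An analytic function $q$ is a subordinant if $q\prec P$ for all solutions $P$. A univalent subordinant $\tilde q$ with $q\prec\tilde q$ for all subordinants $q$ is the best subordinant. (Here $\varphi(u,v)=u+\frac{1-\lambda}{\kappa+1}v$ and $h=\Phi$.) The hypothesis on $z\Phi''(z)/\Phi'(z)$ is understood to include that $\Phi'(z)\ne0$ in $\mathbb{D}$, so that the quotient is defined. *)

theory Defs
  imports "HOL-Complex_Analysis.Complex_Analysis"
begin

abbreviation unit_disc :: "complex set" where
  "unit_disc \<equiv> ball 0 1"

definition univalent :: "(complex \<Rightarrow> complex) \<Rightarrow> bool" where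
  "univalent f \<longleftrightarrow> f holomorphic_on unit_disc \<and> inj_on f unit_disc"

definition class_A :: "(complex \<Rightarrow> complex) set" where
  "class_A = {f. univalent f \<and> f 0 = 0 \<and> deriv f 0 = 1}"

text \<open>The class \<open>H[1,1]\<close>: analytic functions with power series \<open>1 + a\<^sub>1 z + \<dots>\<close>.\<close>

definition class_H11 :: "(complex \<Rightarrow> complex) set" where
  "class_H11 = {f. f holomorphic_on unit_disc \<and> f 0 = 1}"

definition taylor_coeff :: "(complex \<Rightarrow> complex) \<Rightarrow> nat \<Rightarrow> complex" where
  "taylor_coeff f n = (deriv ^^ n) f 0 / fact n"

text \<open>
  The operator \<open>B\<close>; the series over \<open>n \<ge> 1\<close> is written as a series over all
  natural numbers with \<open>Suc n\<close> in place of \<open>n\<close>. The operator is meaningful for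
  \<open>\<nu>\<close> not a nonpositive integer and \<open>f\<close> analytic in the unit disc with
  \<open>f 0 = 0\<close> and \<open>deriv f 0 = 1\<close>.
\<close>

definition B_op :: "complex \<Rightarrow> complex \<Rightarrow> (complex \<Rightarrow> complex) \<Rightarrow> complex \<Rightarrow> complex" where
  "B_op \<nu> c f z = z + (\<Sum>n. taylor_coeff f (Suc n + 1) *
     ((- c / 4) ^ Suc n / pochhammer \<nu> (Suc n)) * (z ^ (Suc n + 1) / fact (Suc n)))"

text \<open>The quotient \<open>B_op \<nu> c f z / z\<close>, with its removable singularity at \<open>0\<close> filled in.\<close>

definition B_quot :: "complex \<Rightarrow> complex \<Rightarrow> (complex \<Rightarrow> complex) \<Rightarrow> complex \<Rightarrow> complex" where
  "B_quot \<nu> c f z = (if z = 0 then 1 else B_op \<nu> c f z / z)"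

definition B_mix :: "real \<Rightarrow> real \<Rightarrow> complex \<Rightarrow> (complex \<Rightarrow> complex) \<Rightarrow> complex \<Rightarrow> complex" where
  "B_mix l \<kappa> c f z =
     of_real (1 - l) * B_quot (of_real (\<kappa> + 1)) c f z
     + of_real l * B_quot (of_real (\<kappa> + 2)) c f z"

definition gamma_const :: "real \<Rightarrow> real \<Rightarrow> real" where
  "gamma_const l \<kappa> =
     ((1 - l)^2 + (\<kappa> + 1)^2 - sqrt ((1 - l)^4 + (\<kappa> + 1)^4)) / (4 * (1 - l) * (\<kappa> + 1))"

definition subordinate :: "(complex \<Rightarrow> complex) \<Rightarrow> (complex \<Rightarrow> complex) \<Rightarrow> bool"
    (infix "\<prec>\<^sub>s" 50) where
  "f \<prec>\<^sub>s F \<longleftrightarrow> f holomorphic_on unit_disc \<and> F holomorphic_on unit_disc \<and>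
     (\<exists>w. w holomorphic_on unit_disc \<and>
          (\<forall>z\<in>unit_disc. norm (w z) \<le> norm z \<and> f z = F (w z)))"

definition exceptional_set :: "(complex \<Rightarrow> complex) \<Rightarrow> complex set" where
  "exceptional_set f = {\<zeta> \<in> sphere 0 1. filterlim f at_infinity (at \<zeta> within unit_disc)}"

text \<open>
  Only the values of \<open>f\<close> inside the unit disc are significant, so membership in \<open>Q\<close>
  is expressed through an analytic continuation \<open>F\<close> of \<open>f\<close> to (a neighbourhood of)
  the closed disc without the exceptional set. By continuity, the values of
  \<open>F\<close> on the closed disc without the exceptional set are determined by \<open>f\<close>.
\<close>

definition class_Q :: "(complex \<Rightarrow> complex) set" where
  "class_Q = {f. \<exists>F. (\<forall>z\<in>unit_disc. F z = f z) \<and>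
     F analytic_on (cball 0 1 - exceptional_set f) \<and>
     inj_on F (cball 0 1 - exceptional_set f) \<and>
     (\<forall>\<zeta> \<in> sphere 0 1 - exceptional_set f. deriv F \<zeta> \<noteq> 0)}"

text \<open>The differential superordination \<open>h(z) \<prec> \<phi>(P(z), z P'(z))\<close>.\<close>

definition superord_solution ::
    "(complex \<Rightarrow> complex \<Rightarrow> complex) \<Rightarrow> (complex \<Rightarrow> complex) \<Rightarrow> (complex \<Rightarrow> complex) \<Rightarrow> bool" where
  "superord_solution \<phi> h P \<longleftrightarrow>
     univalent P \<and> univalent (\<lambda>z. \<phi> (P z) (z * deriv P z)) \<and>
     h \<prec>\<^sub>s (\<lambda>z. \<phi> (P z) (z * deriv P z))"

definition subordinant ::
    "(complex \<Rightarrow> complex \<Rightarrow> complex) \<Rightarrow> (complex \<Rightarrow> complex) \<Rightarrow> (complex \<Rightarrow> complex) \<Rightarrow> bool" where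
  "subordinant \<phi> h q \<longleftrightarrow>
     q holomorphic_on unit_disc \<and> (\<forall>P. superord_solution \<phi> h P \<longrightarrow> q \<prec>\<^sub>s P)"

definition best_subordinant ::
    "(complex \<Rightarrow> complex \<Rightarrow> complex) \<Rightarrow> (complex \<Rightarrow> complex) \<Rightarrow> (complex \<Rightarrow> complex) \<Rightarrow> bool" where
  "best_subordinant \<phi> h q \<longleftrightarrow>
     univalent q \<and> subordinant \<phi> h q \<and> (\<forall>r. subordinant \<phi> h r \<longrightarrow> r \<prec>\<^sub>s q)"

end

theory Submission
  imports Defs
begin

text \<open>
  Write \<open>G = B_quot (\<kappa> + 2) c g\<close> and \<open>d = (1 - l) / (\<kappa> + 1)\<close>. Comparing coefficients gives
  \<open>\<Phi> = G + d z G'\<close>, and likewise for \<open>f\<close>. With \<open>q = 1 + z G'' / G'\<close> the hypothesis on \<open>\<Phi>\<close> bounds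
  the real part of \<open>q + d z q' / (1 + d q)\<close> from below, and Jack's lemma at the first point where
  the real part of \<open>q\<close> vanishes shows that it never does, so \<open>G\<close> is convex.

  Convexity replaces Loewner theory by an elementary flow: for \<open>p \<noteq> G 0\<close> the solutions of
  \<open>d z G' z = s (p - G z)\<close> move strictly inward as \<open>s > 0\<close> decreases. Continuing a solution from
  \<open>s = 1 / t\<close> to \<open>s = 1\<close> puts every value \<open>G z + t d z G' z\<close> with \<open>0 < t \<le> 1\<close> into
  \<open>\<Phi> ` cball 0 |z|\<close>; continuing two solutions towards \<open>s = 0\<close> shows that \<open>\<Phi>\<close> is injective.

  Let \<open>\<Phi>\<close> be subordinate to \<open>H = P + d z P'\<close> with \<open>P\<close> and \<open>H\<close> univalent. If \<open>G\<close> is not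
  subordinate to \<open>P\<close>, then for some \<open>\<rho> < 1\<close> there is a first \<open>z0\<close> with \<open>|z0| < \<rho>\<close> and
  \<open>G z0 = P w0\<close>, \<open>|w0| = \<rho>\<close>. Jack's lemma gives \<open>z0 G' z0 = m w0 P' w0\<close> with \<open>m \<ge> 1\<close>, so
  \<open>H w0 = G z0 + (1 / m) d z0 G' z0\<close> lies in \<open>\<Phi> ` cball 0 |z0|\<close>, hence in \<open>H ` cball 0 |z0|\<close>,
  contradicting the injectivity of \<open>H\<close>. Working on discs of radius \<open>\<rho> < 1\<close> makes boundary
  regularity of \<open>P\<close> irrelevant.
\<close>

subsection \<open>Jack's lemma\<close>

lemma has_real_derivative_norm_square:
  fixes f :: "real \<Rightarrow> complex"
  assumes "(f has_vector_derivative D) (at x)"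
  shows "((\<lambda>t. (norm (f t))\<^sup>2) has_real_derivative 2 * Re (cnj (f x) * D)) (at x)"
proof -
  have Re: "((\<lambda>t. Re (f t)) has_real_derivative Re D) (at x)"
    and Im: "((\<lambda>t. Im (f t)) has_real_derivative Im D) (at x)"
    using assms by (auto simp: has_vector_derivative_complex_iff)
  show ?thesis
    unfolding cmod_power2
    by (rule DERIV_cong[OF DERIV_add[OF DERIV_power[OF Re, of 2] DERIV_power[OF Im, of 2]]])
      (simp add: algebra_simps)
qed

text \<open>The Schwarz lemma bounds \<open>norm (w (t * z0))\<close> by \<open>t\<close> times the
  maximum, with equality at \<open>t = 1\<close>; comparing radial derivatives there gives
  \<open>m \<ge> 1\<close>. Maximality on the circle makes the angular derivative vanish, so the
  factor is real.\<close>

lemma Jack_lemma: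
  assumes holw: "w holomorphic_on S" and S: "open S" "cball 0 (norm z0) \<subseteq> S"
    and w0: "w 0 = 0" and z0: "z0 \<noteq> 0" "w z0 \<noteq> 0"
    and max: "\<And>z. norm z \<le> norm z0 \<Longrightarrow> norm (w z) \<le> norm (w z0)"
  obtains m :: real where "m \<ge> 1" "z0 * deriv w z0 = of_real m * w z0"
proof -
  define R where "R = norm (w z0)"
  have R: "R > 0" using z0 by (simp add: R_def)
  have "z0 \<in> S" using S by auto
  then have dw: "(w has_field_derivative deriv w z0) (at z0)"
    using holw S holomorphic_derivI by blast
  have radial: "norm (w (of_real t * z0)) \<le> t * R" if t: "0 \<le> t" "t \<le> 1" for t :: real
  proof (cases "t = 1")
    case True then show ?thesis by (simp add: R_def)
  next
    case False
    \<comment> \<open>The factor \<open>s < 1\<close> supplies the strict bound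
      \<open>norm (f u) < 1\<close> that the Schwarz lemma asks for; it is removed afterwards by
      letting \<open>s\<close> tend to 1.\<close>
    have "s * (norm (w (of_real t * z0)) / R) \<le> t" if s: "0 < s" "s < 1" for s :: real
    proof -
      define f where "f = (\<lambda>u. of_real s * w (u * z0) / w z0)"
      have sub: "(\<lambda>u. u * z0) ` ball 0 1 \<subseteq> S"
        using S z0 by (auto simp: norm_mult intro!: subsetD[OF S(2)] mult_left_le_one_le)
      have "(\<lambda>u. w (u * z0)) holomorphic_on ball 0 1"
        using holomorphic_on_compose_gen[OF _ holw sub] by (force simp: o_def intro!: holomorphic_intros)
      then have "f holomorphic_on ball 0 1"
        unfolding f_def using z0 by (auto intro!: holomorphic_intros)
      moreover have "f 0 = 0" by (simp add: f_def w0)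
      moreover have "norm (f u) < 1" if "norm u < 1" for u
      proof -
        have "norm (w (u * z0)) \<le> R"
          using that unfolding R_def by (intro max) (auto simp: norm_mult intro!: mult_left_le_one_le)
        then have "s * norm (w (u * z0)) \<le> s * R" using s by simp
        also have "\<dots> < R" using s R by simp
        finally show ?thesis using s R
          by (simp add: f_def norm_mult norm_divide R_def[symmetric])
      qed
      ultimately have "norm (f (of_real t)) \<le> norm (of_real t :: complex)"
        using t False by (intro Schwarz_Lemma(1)) auto
      then show ?thesis using s t by (simp add: f_def norm_mult norm_divide R_def[symmetric])
    qed
    then have "norm (w (of_real t * z0)) / R \<le> t"
      by (rule field_le_mult_one_interval)
    then show ?thesis using R by (simp add: divide_simps)
  qed
  \<comment> \<open>\<open>Q / R\<^sup>2\<close> is the quotient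
    \<open>z0 * deriv w z0 / w z0\<close>. Moving radially controls the real part of
    \<open>Q\<close>, rotating controls its imaginary part.\<close>
  define Q where "Q = cnj (w z0) * (z0 * deriv w z0)"
  have "((\<lambda>t. of_real t * z0) has_vector_derivative z0) (at (1::real))"
    by (auto intro!: derivative_eq_intros)
  then have "((\<lambda>t::real. w (of_real t * z0)) has_vector_derivative z0 * deriv w z0) (at 1)"
    using field_vector_diff_chain_at[of "\<lambda>t. of_real t * z0" z0 1 w "deriv w z0"] dw by (simp add: o_def)
  from has_real_derivative_norm_square[OF this]
  have "((\<lambda>t. (norm (w (of_real t * z0)))\<^sup>2) has_real_derivative 2 * Re Q) (at 1)"
    by (simp add: Q_def)
  then have d1: "((\<lambda>t. (norm (w (of_real t * z0)))\<^sup>2 - (t * R)\<^sup>2) has_real_derivative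
      2 * Re Q - 2 * R\<^sup>2) (at 1)"
    by (rule DERIV_diff) (auto intro!: derivative_eq_intros simp: Q_def power2_eq_square)
  have le: "(norm (w (of_real t * z0)))\<^sup>2 - (t * R)\<^sup>2 \<le> 0" if "0 \<le> t" "t \<le> 1" for t :: real
    using radial[OF that] by (simp add: power_mono)
  \<comment> \<open>A negative derivative would make the difference positive just to the left of 1,
    against \<open>le\<close>.\<close>
  have "2 * Re Q - 2 * R\<^sup>2 \<ge> 0"
  proof (rule ccontr)
    assume "\<not> ?thesis"
    then obtain d where d: "d > 0" "\<And>h. h > 0 \<Longrightarrow> h < d \<Longrightarrow>
       (norm (w (of_real 1 * z0)))\<^sup>2 - (1 * R)\<^sup>2 < (norm (w (of_real (1 - h) * z0)))\<^sup>2 - ((1 - h) * R)\<^sup>2"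
      using DERIV_neg_dec_left[OF d1] by auto
    define h where "h = min (d/2) (1/2)"
    have "h > 0" "h < d" "h \<le> 1" using d(1) by (auto simp: h_def)
    moreover have "(norm (w (of_real 1 * z0)))\<^sup>2 - (1 * R)\<^sup>2 = 0" by (simp add: R_def)
    ultimately show False using d(2)[of h] le[of "1 - h"] by linarith
  qed
  then have ReQ: "Re Q \<ge> R\<^sup>2" by simp
  have "((\<lambda>t. cis t * z0) has_vector_derivative \<i> * z0) (at (0::real))"
    by (auto simp: has_vector_derivative_complex_iff intro!: derivative_eq_intros)
  then have "((\<lambda>t::real. w (cis t * z0)) has_vector_derivative (\<i> * z0) * deriv w z0) (at 0)"
    using field_vector_diff_chain_at[of "\<lambda>t. cis t * z0" "\<i> * z0" 0 w "deriv w z0"] dw by (simp add: o_def)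
  from has_real_derivative_norm_square[OF this]
  have "((\<lambda>t. (norm (w (cis t * z0)))\<^sup>2) has_real_derivative - 2 * Im Q) (at 0)"
    by (rule DERIV_cong) (simp add: Q_def algebra_simps)
  then have "- 2 * Im Q = 0"
    by (rule DERIV_local_max[where d = 1]) (auto intro!: power_mono max simp: norm_mult)
  then have Q: "Q = of_real (Re Q)" by (simp add: complex_eq_iff)
  have "z0 * deriv w z0 * of_real (R\<^sup>2) = Q * w z0"
    unfolding Q_def R_def complex_norm_square by (simp add: algebra_simps)
  then have "z0 * deriv w z0 = of_real (Re Q / R\<^sup>2) * w z0"
    using R by (subst (asm) Q) (simp add: field_simps)
  moreover have "Re Q / R\<^sup>2 \<ge> 1" using ReQ R by simp
  ultimately show thesis using that by blast
qed

subsection \<open>Inward continuation of the solutions of \<open>A z = s B z\<close>\<close>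

text \<open>A local inverse \<open>T\<close> of \<open>S\<close> lifts the real values near
  \<open>s\<close> to a curve through \<open>z1\<close>. By \<open>pos\<close> the squared modulus
  of \<open>T\<close> has positive derivative along it, so lowering the value moves the preimage
  strictly inward.\<close>

lemma descend_step:
  assumes holS: "S holomorphic_on U" and U: "open U" "z1 \<in> U"
    and s: "s > 0" "S z1 = of_real s" and pos: "Re (z1 * deriv S z1 / S z1) > 0" and e: "e > 0"
  shows "\<exists>\<eta>>0. \<forall>s'. s - \<eta> < s' \<and> s' < s \<longrightarrow>
           (\<exists>z'\<in>U. dist z1 z' < e \<and> norm z' < norm z1 \<and> S z' = of_real s')"
proof -
  have dnz: "deriv S z1 \<noteq> 0" "z1 \<noteq> 0" using pos by auto
  obtain r where r: "r > 0" "ball z1 r \<subseteq> U \<inter> ball z1 e" "open (S ` ball z1 r)" "inj_on S (ball z1 r)"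
  proof (rule has_complex_derivative_locally_invertible[of S "U \<inter> ball z1 e" z1])
    show "S holomorphic_on U \<inter> ball z1 e" using holS by (rule holomorphic_on_subset) blast
  qed (use U e dnz in auto)
  have hol: "S holomorphic_on ball z1 r" using holS r(2) by (meson holomorphic_on_subset le_inf_iff)
  obtain T where T: "T holomorphic_on S ` ball z1 r"
    "\<And>z. z \<in> ball z1 r \<Longrightarrow> deriv S z * deriv T (S z) = 1"
    "\<And>z. z \<in> ball z1 r \<Longrightarrow> T (S z) = z"
    using holomorphic_has_inverse[OF hol open_ball r(4)] by blast
  have z1: "z1 \<in> ball z1 r" using r by simp
  then have Ts: "T (of_real s) = z1" and dT: "deriv S z1 * deriv T (of_real s) = 1"
    using T s by metis+
  have "(T has_field_derivative deriv T (of_real s)) (at (of_real s))"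
    using T(1) r(3) z1 s by (intro holomorphic_derivI[OF T(1) r(3)]) (metis imageI)
  moreover have "(of_real has_vector_derivative (1::complex)) (at s)"
    by (auto intro!: derivative_eq_intros)
  ultimately have "((\<lambda>t. T (of_real t)) has_vector_derivative deriv T (of_real s)) (at s)"
    using field_vector_diff_chain_at[of of_real 1 s T "deriv T (of_real s)"] by (simp add: o_def)
  from has_real_derivative_norm_square[OF this]
  have der: "((\<lambda>t. (norm (T (of_real t)))\<^sup>2) has_real_derivative
      2 * Re (cnj z1 * deriv T (of_real s))) (at s)"
    by (simp add: Ts)
  \<comment> \<open>\<open>q\<close> is the logarithmic derivative of \<open>S\<close> at
    \<open>z1\<close>. Inverting it gives \<open>T' = z1 / (s * q)\<close> at \<open>s\<close>, so
    the sign of the derivative in \<open>der\<close> is that of \<open>Re (1 / q)\<close>.\<close>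
  define q where "q = z1 * deriv S z1 / S z1"
  have q: "Re q > 0" "q \<noteq> 0" using pos by (auto simp: q_def)
  have "deriv T (of_real s) = 1 / deriv S z1" using dT dnz by (simp add: field_simps)
  also have "\<dots> = z1 / of_real s / q" using dnz s by (simp add: q_def field_simps)
  also have "cnj z1 * \<dots> = of_real ((norm z1)\<^sup>2 / s) * inverse q"
    by (simp only: of_real_divide complex_norm_square) (simp add: field_simps)
  finally have "Re (cnj z1 * deriv T (of_real s)) = (norm z1)\<^sup>2 / s * Re (inverse q)"
    by simp
  moreover have "Re (inverse q) > 0"
    using q by (simp add: complex_inverse sum_power2_gt_zero_iff complex_eq_iff)
  ultimately have "Re (cnj z1 * deriv T (of_real s)) > 0"
    using s dnz by (metis divide_pos_pos mult_pos_pos zero_less_norm_iff zero_less_power)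
  then have "2 * Re (cnj z1 * deriv T (of_real s)) > 0" by linarith
  from DERIV_pos_inc_left[OF der this] obtain d where
    d: "d > 0" "\<And>h. 0 < h \<Longrightarrow> h < d \<Longrightarrow> (norm (T (of_real (s - h))))\<^sup>2 < (norm (T (of_real s)))\<^sup>2"
    by blast
  have "of_real s \<in> S ` ball z1 r" using z1 s by (metis imageI)
  then obtain \<epsilon> where \<epsilon>: "\<epsilon> > 0" "ball (of_real s) \<epsilon> \<subseteq> S ` ball z1 r"
    using r(3) openE by blast
  show ?thesis
  proof (intro exI[of _ "min d \<epsilon>"] conjI allI impI)
    show "min d \<epsilon> > 0" using d \<epsilon> by simp
    fix s' assume s': "s - min d \<epsilon> < s' \<and> s' < s"
    have "dist (of_real s) (of_real s' :: complex) = s - s'"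
      using s' by (metis abs_of_pos diff_gt_0_iff_gt dist_norm norm_of_real of_real_diff)
    moreover have lt: "s - s' < \<epsilon>" "s - s' < d" using s' by (auto simp: min_def split: if_splits)
    ultimately have "of_real s' \<in> S ` ball z1 r" by (intro subsetD[OF \<epsilon>(2)]) simp
    then obtain z' where z': "z' \<in> ball z1 r" "S z' = of_real s'" by force
    then have "T (of_real s') = z'" using T(3) by metis
    then have "(norm z')\<^sup>2 < (norm z1)\<^sup>2"
      using d(2)[of "s - s'"] s' lt by (simp add: Ts)
    then have "norm z' < norm z1" by (simp add: power_less_imp_less_base)
    then show "\<exists>z'\<in>U. dist z1 z' < e \<and> norm z' < norm z1 \<and> S z' = of_real s'"
      using z' r(2) by (intro bexI[of _ z']) auto
  qed
qed

text \<open>For \<open>s > 0\<close> the equation \<open>A z = s * B z\<close> says that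
  \<open>S = A / B\<close> takes the value \<open>s\<close>, and at such points the quotient in
  \<open>pos\<close> equals \<open>z * S' / S\<close>. A constant \<open>B\<close> will give
  injectivity of \<open>G\<close>; \<open>B z = p - G z\<close> will serve for
  \<open>Phi\<close>.\<close>

locale radial_quotient =
  fixes A B :: "complex \<Rightarrow> complex"
  assumes holA: "A holomorphic_on ball 0 1" and holB: "B holomorphic_on ball 0 1"
    and A0: "A 0 = 0" and A1: "deriv A 0 \<noteq> 0" and B0: "B 0 \<noteq> 0"
    and Anz: "\<And>z. z \<in> ball 0 1 \<Longrightarrow> z \<noteq> 0 \<Longrightarrow> A z \<noteq> 0"
    and pos: "\<And>z s. z \<in> ball 0 1 \<Longrightarrow> s > 0 \<Longrightarrow> A z = of_real s * B z \<Longrightarrow>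
      Re (z * (deriv A z - of_real s * deriv B z) / A z) > 0"
begin

lemma B_nz:
  assumes "z \<in> ball 0 1" "A z = of_real s * B z"
  shows "B z \<noteq> 0"
  using assms Anz B0 by (metis mult_zero_right)

lemma open_nonpole: "open {z \<in> ball 0 1. B z \<noteq> 0}"
proof -
  have "{z \<in> ball 0 1. B z \<noteq> 0} = ball 0 1 \<inter> B -` (- {0})" by auto
  then show ?thesis
    using continuous_open_preimage[OF holomorphic_on_imp_continuous_on[OF holB] open_ball, of "- {0}"]
    by (simp add: open_Compl)
qed

lemma hol_quotient: "(\<lambda>z. A z / B z) holomorphic_on {z \<in> ball 0 1. B z \<noteq> 0}"
proof -
  have "A holomorphic_on {z \<in> ball 0 1. B z \<noteq> 0}" "B holomorphic_on {z \<in> ball 0 1. B z \<noteq> 0}"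
    by (rule holomorphic_on_subset[OF holA] holomorphic_on_subset[OF holB], blast)+
  then show ?thesis by (intro holomorphic_on_divide) auto
qed

lemma deriv_quotient:
  assumes "z \<in> ball 0 1" "B z \<noteq> 0"
  shows "deriv (\<lambda>z. A z / B z) z = (deriv A z * B z - A z * deriv B z) / (B z)\<^sup>2"
  using holA holB assms
  by (subst deriv_divide) (auto intro: holomorphic_on_imp_differentiable_at)

lemma step:
  assumes z: "z \<in> ball 0 1" and s: "s > 0" "A z = of_real s * B z" and e: "e > 0"
  shows "\<exists>\<eta>>0. \<forall>s'. s - \<eta> < s' \<and> s' < s \<longrightarrow>
           (\<exists>z'. dist z z' < e \<and> norm z' < norm z \<and> A z' = of_real s' * B z')"
proof -
  have nz: "B z \<noteq> 0" using B_nz z s by blast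
  then have Anz: "A z \<noteq> 0" using s by simp
  have "deriv (\<lambda>z. A z / B z) z = (deriv A z - of_real s * deriv B z) / B z"
    using nz s by (simp add: deriv_quotient[OF z nz] power2_eq_square field_simps)
  then have "z * deriv (\<lambda>z. A z / B z) z / (A z / B z) = z * (deriv A z - of_real s * deriv B z) / A z"
    using nz by simp
  then have "\<exists>\<eta>>0. \<forall>s'. s - \<eta> < s' \<and> s' < s \<longrightarrow>
           (\<exists>z'\<in>{z \<in> ball 0 1. B z \<noteq> 0}. dist z z' < e \<and> norm z' < norm z \<and> A z' / B z' = of_real s')"
    using pos[OF z s] nz z s e
    by (intro descend_step[OF hol_quotient open_nonpole]) auto
  then obtain \<eta> where \<eta>: "\<eta> > 0" "\<And>s'. s - \<eta> < s' \<Longrightarrow> s' < s \<Longrightarrow>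
      \<exists>z'\<in>{z \<in> ball 0 1. B z \<noteq> 0}. dist z z' < e \<and> norm z' < norm z \<and> A z' / B z' = of_real s'"
    by blast
  have "\<exists>z'. dist z z' < e \<and> norm z' < norm z \<and> A z' = of_real s' * B z'"
    if s': "s - \<eta> < s'" "s' < s" for s'
  proof -
    obtain z' where "B z' \<noteq> 0" "dist z z' < e" "norm z' < norm z" "A z' / B z' = of_real s'"
      using \<eta>(2)[OF s'] by blast
    then show ?thesis by (intro exI[of _ z']) (simp add: field_simps)
  qed
  with \<eta>(1) show ?thesis by blast
qed

lemma cont_AB: "r < 1 \<Longrightarrow> continuous_on (cball 0 r) A" "r < 1 \<Longrightarrow> continuous_on (cball 0 r) B"
  by (rule holomorphic_on_imp_continuous_on, rule holomorphic_on_subset[OF holA] holomorphic_on_subset[OF holB], force)+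

text \<open>The pairs of a parameter in \<open>{s1..s0}\<close> and a solution in the closed disc of
  radius \<open>norm z0\<close> form a compact set. Its least parameter must be \<open>s1\<close>:
  otherwise \<open>step\<close> lowers it further without leaving the disc.\<close>

lemma exists_descent:
  assumes z0: "z0 \<in> ball 0 1" "A z0 = of_real s0 * B z0" and s1: "0 < s1" "s1 \<le> s0"
  obtains z where "norm z \<le> norm z0" "A z = of_real s1 * B z"
proof -
  define r where "r = norm z0"
  have r: "r < 1" using z0 by (simp add: r_def)
  define K where "K = {x \<in> {s1..s0} \<times> cball 0 r. A (snd x) - of_real (fst x) * B (snd x) = 0}"
  have "closed K" unfolding K_def
    by (intro continuous_closed_preimage_constant continuous_on_diff continuous_on_mult continuous_on_of_real
        continuous_on_compose2[OF cont_AB(1)[OF r]] continuous_on_compose2[OF cont_AB(2)[OF r]]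
        continuous_on_fst continuous_on_snd continuous_on_id closed_Times closed_atLeastAtMost closed_cball) auto
  moreover have "bounded K"
    by (rule bounded_subset[of "{s1..s0} \<times> cball 0 r"]) (auto simp: K_def intro!: bounded_Times)
  ultimately have "compact K" by (simp add: compact_eq_bounded_closed)
  then have "compact (fst ` K)"
    by (rule compact_continuous_image[OF continuous_on_fst[OF continuous_on_id]])
  moreover have "(s0, z0) \<in> K" using z0 s1 by (auto simp: K_def r_def)
  ultimately obtain s where s: "s \<in> fst ` K" "\<And>t. t \<in> fst ` K \<Longrightarrow> s \<le> t"
    using compact_attains_inf[of "fst ` K"] by blast
  then obtain z where z: "(s, z) \<in> K" by force
  have "s = s1"
  proof (rule ccontr)
    assume "s \<noteq> s1"
    then have *: "s > s1" "s \<le> s0" "A z = of_real s * B z" "norm z \<le> r" using z by (auto simp: K_def)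
    then have "z \<in> ball 0 1" "s > 0" using r s1 by auto
    from step[OF this *(3) zero_less_one] obtain \<eta> where
      \<eta>: "\<eta> > 0" "\<forall>s'. s - \<eta> < s' \<and> s' < s \<longrightarrow>
           (\<exists>z'. dist z z' < 1 \<and> norm z' < norm z \<and> A z' = of_real s' * B z')"
      by (elim exE conjE)
    define s' where "s' = max s1 (s - \<eta> / 2)"
    have s': "s - \<eta> < s'" "s' < s" "s1 \<le> s'" using *(1) \<eta>(1) unfolding s'_def by linarith+
    then obtain z' where z': "norm z' < norm z" "A z' = of_real s' * B z'" using \<eta>(2) by blast
    then have "norm z' \<le> r" "s' \<le> s0" using * s' by linarith+
    then have "(s', z') \<in> K" using z' s' by (simp add: K_def)
    then have "s \<le> s'" using s(2)[of s'] image_eqI[of s' fst "(s', z')" K] by simp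
    with \<open>s' < s\<close> show False by simp
  qed
  with z have "norm z \<le> norm z0" "A z = of_real s1 * B z" by (auto simp: K_def r_def)
  then show thesis by (rule that)
qed

text \<open>Among all pairs of distinct solutions with a common parameter, one has the least
  parameter, by compactness. If it is 0, both solutions are 0, since \<open>A\<close> vanishes only
  there; if it is positive, \<open>step\<close> moves both solutions to a smaller parameter and
  keeps them apart.\<close>

lemma solution_unique:
  assumes z: "z1 \<in> ball 0 1" "z2 \<in> ball 0 1" and s0: "s0 > 0"
    and eq: "A z1 = of_real s0 * B z1" "A z2 = of_real s0 * B z2"
  shows "z1 = z2"
proof (rule ccontr)
  assume ne: "z1 \<noteq> z2"
  define r where "r = max (norm z1) (norm z2)"
  have r: "r < 1" using z by (simp add: r_def)
  define K where "K = {x \<in> {0..s0} \<times> cball 0 r \<times> cball 0 r.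
      A (fst (snd x)) - of_real (fst x) * B (fst (snd x)) = 0} \<inter>
      {x \<in> {0..s0} \<times> cball 0 r \<times> cball 0 r.
      A (snd (snd x)) - of_real (fst x) * B (snd (snd x)) = 0}"
  have closed_sol: "closed {x \<in> {0..s0} \<times> cball 0 r \<times> cball 0 r. A (f x) - of_real (fst x) * B (f x) = 0}"
    if f: "continuous_on ({0..s0} \<times> cball 0 r \<times> cball 0 r) f"
      "f ` ({0..s0} \<times> cball 0 r \<times> cball 0 r) \<subseteq> cball 0 r" for f :: "real \<times> complex \<times> complex \<Rightarrow> complex"
  proof (rule continuous_closed_preimage_constant)
    show "continuous_on ({0..s0} \<times> cball 0 r \<times> cball 0 r) (\<lambda>x. A (f x) - of_real (fst x) * B (f x))"
      by (intro continuous_on_diff continuous_on_mult continuous_on_of_real continuous_on_fst continuous_on_id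
          continuous_on_compose2[OF cont_AB(1)[OF r] f] continuous_on_compose2[OF cont_AB(2)[OF r] f])
  qed (intro closed_Times closed_atLeastAtMost closed_cball)
  have cK: "closed K" unfolding K_def
  proof (rule closed_Int[OF closed_sol closed_sol])
    show "continuous_on ({0..s0} \<times> cball 0 r \<times> cball 0 r) (\<lambda>x. fst (snd x))"
      "continuous_on ({0..s0} \<times> cball 0 r \<times> cball 0 r) (\<lambda>x. snd (snd x))"
      by (intro continuous_on_fst continuous_on_snd continuous_on_id)+
  qed (simp_all add: image_subset_iff)
  define D where "D = K \<inter> {x. fst (snd x) \<noteq> snd (snd x)}"
  \<comment> \<open>Distinct solutions cannot merge in the limit, because \<open>A / B\<close> is locally injective at solutions.\<close>
  have "closed D"
    unfolding closed_sequential_limits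
  proof (intro allI impI, elim conjE)
    fix x l assume x: "\<forall>n. x n \<in> D" and lim: "x \<longlonglongrightarrow> l"
    have "\<forall>n. x n \<in> K" using x by (simp add: D_def)
    then have lK: "l \<in> K" using cK lim unfolding closed_sequential_limits by blast
    obtain s y y' where l: "l = (s, y, y')" by (metis prod.exhaust)
    have "y \<noteq> y'"
    proof
      assume "y = y'"
      have sy: "0 \<le> s" "norm y \<le> r" "A y = of_real s * B y" using lK by (auto simp: l K_def)
      have yb: "y \<in> ball 0 1" using sy r by simp
      have nz: "B y \<noteq> 0" using B_nz[OF yb sy(3)] .
      \<comment> \<open>This is the numerator of the derivative of \<open>A / B\<close>. At
        \<open>y = 0\<close> the parameter is 0 and \<open>pos\<close> says nothing, so
        \<open>A1\<close> is used instead.\<close>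
      have "deriv A y * B y - A y * deriv B y \<noteq> 0"
      proof (cases "y = 0")
        case True then show ?thesis using A0 A1 B0 by simp
      next
        case False
        then have "s > 0" using Anz[OF yb] sy by (cases "s = 0") auto
        from pos[OF yb this sy(3)] have "deriv A y - of_real s * deriv B y \<noteq> 0" by auto
        moreover have "deriv A y * B y - A y * deriv B y = (deriv A y - of_real s * deriv B y) * B y"
          by (simp add: sy algebra_simps)
        ultimately show ?thesis using nz by simp
      qed
      then have "deriv (\<lambda>z. A z / B z) y \<noteq> 0" using deriv_quotient[OF yb nz] nz by simp
      then obtain \<rho> where \<rho>: "\<rho> > 0" "inj_on (\<lambda>z. A z / B z) (ball y \<rho>)" "ball y \<rho> \<subseteq> {z \<in> ball 0 1. B z \<noteq> 0}"
        using has_complex_derivative_locally_injective[OF hol_quotient _ open_nonpole, of y] yb nz by blast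
      have l1: "(\<lambda>n. fst (snd (x n))) \<longlonglongrightarrow> y" "(\<lambda>n. snd (snd (x n))) \<longlonglongrightarrow> y"
        using tendsto_fst[OF tendsto_snd[OF lim]] tendsto_snd[OF tendsto_snd[OF lim]] \<open>y = y'\<close>
        by (auto simp: l)
      have "\<forall>\<^sub>F n in sequentially. fst (snd (x n)) \<in> ball y \<rho> \<and> snd (snd (x n)) \<in> ball y \<rho>"
        using \<rho>(1) by (intro eventually_conj topological_tendstoD[OF l1(1)] topological_tendstoD[OF l1(2)]) auto
      then obtain n where n: "fst (snd (x n)) \<in> ball y \<rho>" "snd (snd (x n)) \<in> ball y \<rho>"
        unfolding eventually_sequentially by blast
      have "B (fst (snd (x n))) \<noteq> 0" "B (snd (snd (x n))) \<noteq> 0"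
        using subsetD[OF \<rho>(3) n(1)] subsetD[OF \<rho>(3) n(2)] by auto
      moreover have "x n \<in> D" using x by blast
      ultimately have "A (fst (snd (x n))) / B (fst (snd (x n))) = A (snd (snd (x n))) / B (snd (snd (x n)))"
        by (simp add: D_def K_def)
      with inj_onD[OF \<rho>(2) _ n] have "fst (snd (x n)) = snd (snd (x n))" by simp
      with \<open>x n \<in> D\<close> show False by (simp add: D_def)
    qed
    with lK show "l \<in> D" by (simp add: D_def l)
  qed
  moreover have "bounded D"
    by (rule bounded_subset[of "{0..s0} \<times> cball 0 r \<times> cball 0 r"])
       (intro bounded_Times bounded_closed_interval bounded_cball, unfold D_def K_def, blast)
  ultimately have "compact D" by (simp add: compact_eq_bounded_closed)
  then have "compact (fst ` D)"
    by (rule compact_continuous_image[OF continuous_on_fst[OF continuous_on_id]])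
  moreover have "(s0, z1, z2) \<in> D" using z s0 ne eq by (auto simp: D_def K_def r_def)
  ultimately obtain s where s: "s \<in> fst ` D" "\<And>t. t \<in> fst ` D \<Longrightarrow> s \<le> t"
    using compact_attains_inf[of "fst ` D"] by blast
  then obtain y1 y2 where "(s, y1, y2) \<in> D" by (metis imageE prod.collapse)
  then have y: "y1 \<noteq> y2" "norm y1 \<le> r" "norm y2 \<le> r" "0 \<le> s" "s \<le> s0"
      "A y1 = of_real s * B y1" "A y2 = of_real s * B y2"
    by (auto simp: D_def K_def)
  have yb: "y1 \<in> ball 0 1" "y2 \<in> ball 0 1" using y r by auto
  have "s \<noteq> 0"
  proof
    assume "s = 0"
    then have "A y1 = 0" "A y2 = 0" using y by auto
    then show False using Anz[OF yb(1)] Anz[OF yb(2)] y(1) by blast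
  qed
  then have "s > 0" using y by simp
  \<comment> \<open>Points moved by less than half the distance cannot meet.\<close>
  define e where "e = dist y1 y2 / 2"
  have "e > 0" using y by (simp add: e_def)
  obtain \<eta>1 where \<eta>1: "\<eta>1 > 0" "\<And>s'. s - \<eta>1 < s' \<Longrightarrow> s' < s \<Longrightarrow>
      \<exists>z'. dist y1 z' < e \<and> norm z' < norm y1 \<and> A z' = of_real s' * B z'"
    using step[OF yb(1) \<open>s > 0\<close> y(6) \<open>e > 0\<close>] by metis
  obtain \<eta>2 where \<eta>2: "\<eta>2 > 0" "\<And>s'. s - \<eta>2 < s' \<Longrightarrow> s' < s \<Longrightarrow>
      \<exists>z'. dist y2 z' < e \<and> norm z' < norm y2 \<and> A z' = of_real s' * B z'"
    using step[OF yb(2) \<open>s > 0\<close> y(7) \<open>e > 0\<close>] by metis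
  define s' where "s' = max (s / 2) (s - min \<eta>1 \<eta>2 / 2)"
  have s': "s - \<eta>1 < s'" "s - \<eta>2 < s'" "s' < s" "s' > 0"
    using \<open>s > 0\<close> \<eta>1(1) \<eta>2(1) unfolding s'_def by linarith+
  obtain u1 where u1: "dist y1 u1 < e" "norm u1 < norm y1" "A u1 = of_real s' * B u1"
    using \<eta>1(2) s' by blast
  obtain u2 where u2: "dist y2 u2 < e" "norm u2 < norm y2" "A u2 = of_real s' * B u2"
    using \<eta>2(2) s' by blast
  have "u1 \<noteq> u2"
    using u1(1) u2(1) dist_triangle2[of y1 y2 u1] by (auto simp: e_def)
  moreover have "norm u1 \<le> r" "norm u2 \<le> r" "s' \<le> s0" using u1(2) u2(2) y s'(3) by linarith+
  ultimately have "(s', u1, u2) \<in> D" using u1(3) u2(3) s'(4) by (simp add: D_def K_def)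
  then have "s \<le> s'" using s(2)[of s'] image_eqI[of s' fst "(s', u1, u2)" D] by simp
  with s' show False by simp
qed

end

subsection \<open>A Briot--Bouquet differential subordination\<close>

text \<open>With \<open>v = 1 + z k' / k\<close> one has \<open>m = k * (a + b * v)\<close> and
  \<open>1 + z m' / m = v + b z v' / (a + b * v)\<close>. Where \<open>Re v\<close> first vanishes,
  Jack's lemma for the Cayley transform of \<open>v\<close> pushes the real part of the right-hand
  side down to \<open>-\<gamma>\<close> or below, contradicting \<open>mpos\<close>.\<close>

lemma briot_bouquet_positive:
  fixes a b \<gamma> :: real
  assumes holk: "k holomorphic_on ball 0 1"
    and ab: "a \<ge> 0" "b > 0"
    and m: "\<And>z. z \<in> ball 0 1 \<Longrightarrow> m z = of_real (a + b) * k z + of_real b * (z * deriv k z)"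
    and mnz: "\<And>z. z \<in> ball 0 1 \<Longrightarrow> m z \<noteq> 0"
    and mpos: "\<And>z. z \<in> ball 0 1 \<Longrightarrow> Re (1 + z * deriv m z / m z) > - \<gamma>"
    and \<gamma>: "\<And>s. 2 * \<gamma> * (a\<^sup>2 + b\<^sup>2 * s\<^sup>2) \<le> a * b * (1 + s\<^sup>2)"
    and z: "z \<in> ball 0 1"
  shows "k z \<noteq> 0" and "Re (1 + z * deriv k z / k z) > 0"
proof -
  \<comment> \<open>\<open>h\<close> is \<open>Re v\<close> times the squared modulus of
    \<open>k\<close>. It contains no division, so it can be used before \<open>k\<close> is known to
    have no zeros.\<close>
  define h where "h = (\<lambda>z. Re ((k z + z * deriv k z) * cnj (k z)))"
  have contk: "continuous_on (ball 0 1) k" "continuous_on (ball 0 1) (deriv k)"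
    using holk by (auto intro!: holomorphic_on_imp_continuous_on holomorphic_deriv)
  then have conth: "continuous_on (ball 0 1) h"
    unfolding h_def by (intro continuous_intros)
  have hk: "k u \<noteq> 0" if "h u > 0" for u using that by (auto simp: h_def)
  have k0: "k 0 \<noteq> 0" using m[of 0] mnz[of 0] by auto
  have "h z > 0"
  proof (rule ccontr)
    assume "\<not> h z > 0"
    \<comment> \<open>A point of \<open>X\<close> nearest to the origin is the critical point:
      \<open>h\<close> is positive on the open disc through it.\<close>
    define X where "X = {u \<in> cball 0 (norm z). h u \<in> {..0}}"
    have sub: "cball 0 (norm z) \<subseteq> ball 0 1" using z by auto
    have "closed X"
      unfolding X_def
      using continuous_closed_preimage[OF continuous_on_subset[OF conth sub] closed_cball closed_atMost]
      by (simp add: vimage_def Int_def)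
    moreover have "bounded X" by (rule bounded_subset[OF bounded_cball[of 0 "norm z"]]) (auto simp: X_def)
    ultimately have "compact X" by (simp add: compact_eq_bounded_closed)
    moreover have "z \<in> X" using \<open>\<not> h z > 0\<close> by (simp add: X_def)
    ultimately obtain z0 where z0: "z0 \<in> X" "\<And>u. u \<in> X \<Longrightarrow> norm z0 \<le> norm u"
      using continuous_attains_inf[of X norm] continuous_on_norm_id by blast
    have z0b: "norm z0 < 1" "h z0 \<le> 0" using z0(1) z by (auto simp: X_def)
    have "h 0 > 0" using k0 by (simp add: h_def complex_neq_0 flip: power2_eq_square)
    then have z0nz: "z0 \<noteq> 0" using z0b by auto
    have hpos: "h u > 0" if "norm u < norm z0" for u
      using z0(2)[of u] z0(1) that by (force simp: X_def)
    have sub0: "cball 0 (norm z0) \<subseteq> ball 0 1" using z0b by auto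
    have hnn: "h u \<ge> 0" if "norm u \<le> norm z0" for u
    proof (rule continuous_ge_on_closure[where S = "ball 0 (norm z0)" and f = h])
      show "continuous_on (closure (ball 0 (norm z0))) h"
        using conth sub0 z0nz by (auto intro: continuous_on_subset)
    qed (use that z0nz hpos in \<open>auto intro: less_imp_le\<close>)
    have knz: "k u \<noteq> 0" if u: "norm u \<le> norm z0" for u
    proof (cases "u = 0")
      case False
      \<comment> \<open>\<open>|z k z|\<close> is nondecreasing along radii, so \<open>k\<close> has no zero on the critical circle.\<close>
      define K where "K = (\<lambda>z. z * k z)"
      have "(norm (K (of_real (1/2) * u)))\<^sup>2 \<le> (norm (K (of_real 1 * u)))\<^sup>2"
      proof (rule DERIV_nonneg_imp_nondecreasing[of "1/2" 1 "\<lambda>t. (norm (K (of_real t * u)))\<^sup>2"])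
        fix t :: real assume t: "1/2 \<le> t" "t \<le> 1"
        have tu: "norm (of_real t * u) \<le> norm z0"
          using t u mult_left_le_one_le[of "norm u" t] by (simp add: norm_mult)
        then have "of_real t * u \<in> ball 0 1" using z0b by simp
        then have "(K has_field_derivative k (t * u) + t * u * deriv k (t * u)) (at (t * u))"
          unfolding K_def using holomorphic_derivI[OF holk open_ball]
          by (auto intro!: derivative_eq_intros)
        moreover have "((\<lambda>t. of_real t * u) has_vector_derivative u) (at t)"
          by (auto intro!: derivative_eq_intros)
        ultimately have "((\<lambda>t. K (of_real t * u)) has_vector_derivative u * (k (t * u) + t * u * deriv k (t * u))) (at t)"
          using field_vector_diff_chain_at[of "\<lambda>t. of_real t * u" u t K] by (simp add: o_def)
        from has_real_derivative_norm_square[OF this]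
        have der: "((\<lambda>t. (norm (K (of_real t * u)))\<^sup>2) has_real_derivative
            2 * Re (cnj (K (t * u)) * (u * (k (t * u) + t * u * deriv k (t * u))))) (at t)" .
        have "cnj (K (t * u)) * (u * (k (t * u) + t * u * deriv k (t * u)))
            = of_real (t * (norm u)\<^sup>2) * ((k (t * u) + t * u * deriv k (t * u)) * cnj (k (t * u)))"
          by (simp only: of_real_mult complex_norm_square K_def complex_cnj_mult complex_cnj_complex_of_real)
             (simp add: algebra_simps)
        moreover have "Re (of_real r * y) = r * Re y" for r y by simp
        ultimately have "Re (cnj (K (t * u)) * (u * (k (t * u) + t * u * deriv k (t * u)))) = t * (norm u)\<^sup>2 * h (t * u)"
          by (simp only: h_def)
        then have "((\<lambda>t. (norm (K (of_real t * u)))\<^sup>2) has_real_derivative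
            2 * (t * (norm u)\<^sup>2 * h (t * u))) (at t)" using der by (simp only:)
        moreover have "2 * (t * (norm u)\<^sup>2 * h (t * u)) \<ge> 0" using t hnn[OF tu] by simp
        ultimately show "\<exists>y. ((\<lambda>t. (norm (K (of_real t * u)))\<^sup>2) has_real_derivative y) (at t) \<and> 0 \<le> y"
          by blast
      qed simp
      moreover have "norm z0 > 0" using z0nz by simp
      with u have "norm u / 2 < norm z0" by linarith
      then have "norm (of_real (1/2) * u) < norm z0" by (simp add: norm_mult)
      then have "k (of_real (1/2) * u) \<noteq> 0" by (intro hk hpos)
      ultimately show ?thesis using False by (auto simp: K_def)
    qed (use k0 in simp)
    define v where "v = (\<lambda>z. 1 + z * deriv k z / k z)"
    define S where "S = ball 0 1 \<inter> k -` (- {0})"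
    have S: "open S" unfolding S_def by (intro continuous_open_preimage[OF contk(1)] open_ball) auto
    have cS: "cball 0 (norm z0) \<subseteq> S" using sub0 knz by (auto simp: S_def)
    have holkS: "k holomorphic_on S" using holk by (rule holomorphic_on_subset) (auto simp: S_def)
    have holv: "v holomorphic_on S" unfolding v_def
      by (intro holomorphic_intros holkS holomorphic_deriv S) (auto simp: S_def)
    have Rev: "Re (v u) = h u / (norm (k u))\<^sup>2" if "u \<in> S" for u
    proof -
      have "k u \<noteq> 0" using that by (simp add: S_def)
      then have "v u = ((k u + u * deriv k u) * cnj (k u)) / of_real ((norm (k u))\<^sup>2)"
        unfolding complex_norm_square by (simp add: v_def field_simps)
      then show ?thesis by (simp only: Re_divide_of_real h_def)
    qed
    have vnn: "Re (v u) \<ge> 0" if "norm u \<le> norm z0" for u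
      using Rev[of u] hnn[OF that] cS that by auto
    have z0S: "z0 \<in> S" using cS by auto
    have v0: "Re (v z0) = 0" using Rev[OF z0S] z0b(2) hnn[of z0] by simp
    define S' where "S' = S \<inter> v -` (- {-1})"
    have S': "open S'" unfolding S'_def
      by (intro continuous_open_preimage[OF holomorphic_on_imp_continuous_on[OF holv]] S) auto
    have cS': "cball 0 (norm z0) \<subseteq> S'" using cS vnn by (fastforce simp: S'_def)
    have holvS': "v holomorphic_on S'" using holv by (rule holomorphic_on_subset) (auto simp: S'_def)
    \<comment> \<open>The Cayley transform takes the right half-plane to the unit disc. It vanishes
      at the origin because \<open>v 0 = 1\<close>, and has modulus 1 at \<open>z0\<close> because
      \<open>Re (v z0) = 0\<close>.\<close>
    define w where "w = (\<lambda>z. (v z - 1) / (v z + 1))"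
    have vne: "v u + 1 \<noteq> 0" if "u \<in> S'" for u
      using that by (auto simp: S'_def add_eq_0_iff2)
    have holw: "w holomorphic_on S'" unfolding w_def
      using vne by (intro holomorphic_intros holvS') auto
    have normw: "norm (w u) \<le> 1" if "norm u \<le> norm z0" for u
    proof -
      have "(norm (v u - 1))\<^sup>2 \<le> (norm (v u + 1))\<^sup>2"
        using vnn[OF that] unfolding cmod_power2 by (simp add: power2_eq_square algebra_simps)
      then have "norm (v u - 1) \<le> norm (v u + 1)" by (rule power2_le_imp_le) simp
      then show ?thesis by (simp add: w_def norm_divide divide_le_eq_1)
    qed
    have z0S': "z0 \<in> S'" using cS' by auto
    have "(norm (v z0 - 1))\<^sup>2 = (norm (v z0 + 1))\<^sup>2"
      using v0 unfolding cmod_power2 by simp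
    then have "norm (v z0 - 1) = norm (v z0 + 1)" by simp
    then have normw0: "norm (w z0) = 1" using vne[OF z0S'] by (simp add: w_def norm_divide)
    have "w 0 = 0" by (simp add: w_def v_def)
    then obtain \<mu> :: real where \<mu>: "\<mu> \<ge> 1" "z0 * deriv w z0 = of_real \<mu> * w z0"
      using Jack_lemma[OF holw S' cS' _ z0nz] normw normw0 by (metis norm_zero zero_neq_one)
    define s where "s = Im (v z0)"
    have vs: "v z0 = \<i> * of_real s" using v0 by (simp add: s_def complex_eq_iff)
    have dv: "(v has_field_derivative deriv v z0) (at z0)"
      using holomorphic_derivI[OF holv S z0S] .
    then have "(w has_field_derivative 2 * deriv v z0 / (v z0 + 1)\<^sup>2) (at z0)"
      unfolding w_def using vne[OF z0S']
      by (auto intro!: derivative_eq_intros simp: power2_eq_square algebra_simps)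
    then have "deriv w z0 = 2 * deriv v z0 / (v z0 + 1)\<^sup>2" by (rule DERIV_imp_deriv)
    then have "z0 * (2 * deriv v z0 / (v z0 + 1)\<^sup>2) = of_real \<mu> * ((v z0 - 1) / (v z0 + 1))"
      using \<mu>(2) by (simp add: w_def)
    \<comment> \<open>Jack's lemma solved for \<open>z0 * deriv v z0\<close>; as \<open>v z0\<close>
      is purely imaginary, this is a negative real number.\<close>
    then have "z0 * deriv v z0 = of_real \<mu> * ((v z0 - 1) * (v z0 + 1)) / 2"
      using vne[OF z0S'] by (simp add: divide_simps power2_eq_square) (simp only: ac_simps)
    also have "(v z0 - 1) * (v z0 + 1) = - of_real (1 + s\<^sup>2)"
      unfolding vs by (simp add: algebra_simps power2_eq_square)
    finally have zv: "z0 * deriv v z0 = - of_real (\<mu> * (1 + s\<^sup>2) / 2)" by (simp add: field_simps)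
    have mS: "m u = k u * (of_real a + of_real b * v u)" if "u \<in> S" for u
      using m[of u] that by (simp add: S_def v_def field_simps)
    have "(k has_field_derivative deriv k z0) (at z0)"
      using holomorphic_derivI[OF holkS S z0S] .
    then have "((\<lambda>u. k u * (of_real a + of_real b * v u)) has_field_derivative
        deriv k z0 * (of_real a + of_real b * v z0) + k z0 * (of_real b * deriv v z0)) (at z0)"
      using dv by (auto intro!: derivative_eq_intros)
    then have "(m has_field_derivative
        deriv k z0 * (of_real a + of_real b * v z0) + k z0 * (of_real b * deriv v z0)) (at z0)"
      by (rule has_field_derivative_transform_within_open[OF _ S z0S]) (simp add: mS)
    then have dm: "deriv m z0 = deriv k z0 * (of_real a + of_real b * v z0) + k z0 * (of_real b * deriv v z0)"
      by (rule DERIV_imp_deriv)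
    have nz: "k z0 \<noteq> 0" "of_real a + of_real b * v z0 \<noteq> 0"
      using mnz[of z0] z0b mS[OF z0S] by auto
    have "1 + z0 * deriv m z0 / m z0 = v z0 + of_real b * (z0 * deriv v z0) / (of_real a + of_real b * v z0)"
    proof -
      have "x * (dk * y + k' * (b' * dv)) / (k' * y) = x * dk / k' + b' * (x * dv) / y"
        if "k' \<noteq> 0" "y \<noteq> 0" for x dk y k' b' dv :: complex
        using that by (simp add: field_simps)
      from this[OF nz] show ?thesis
        unfolding dm mS[OF z0S] by (simp add: v_def)
    qed
    also have "\<dots> = v z0 - of_real (b * (\<mu> * (1 + s\<^sup>2) / 2)) / (of_real a + of_real b * v z0)"
      by (simp add: zv)
    also have "Re \<dots> = - (b * (\<mu> * (1 + s\<^sup>2) / 2) * a / (a\<^sup>2 + b\<^sup>2 * s\<^sup>2))"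
    proof -
      have "Re (of_real t / (of_real a + of_real b * (\<i> * of_real s))) = t * a / (a\<^sup>2 + b\<^sup>2 * s\<^sup>2)"
        for t by (simp add: Re_divide power_mult_distrib)
      moreover have "Re (\<i> * of_real s) = 0" by simp
      ultimately show ?thesis unfolding vs minus_complex.sel by (simp only: diff_0)
    qed
    finally have lt: "b * (\<mu> * (1 + s\<^sup>2) / 2) * a / (a\<^sup>2 + b\<^sup>2 * s\<^sup>2) < \<gamma>"
      using mpos[of z0] z0b by simp
    \<comment> \<open>The denominator is the squared modulus of \<open>a + b * v z0\<close>, which
      is nonzero because \<open>m z0\<close> is.\<close>
    have "a \<noteq> 0 \<or> s \<noteq> 0" using nz(2) by (auto simp: vs)
    then have den: "a\<^sup>2 + b\<^sup>2 * s\<^sup>2 > 0" using ab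
      by (auto simp: add_pos_nonneg add_nonneg_pos)
    from lt have "b * (\<mu> * (1 + s\<^sup>2) / 2) * a < \<gamma> * (a\<^sup>2 + b\<^sup>2 * s\<^sup>2)"
      unfolding pos_divide_less_eq[OF den] .
    then have "\<mu> * (a * b * (1 + s\<^sup>2)) < 2 * \<gamma> * (a\<^sup>2 + b\<^sup>2 * s\<^sup>2)" by (simp add: algebra_simps)
    also have "\<dots> \<le> a * b * (1 + s\<^sup>2)" by (rule \<gamma>)
    also have "\<dots> \<le> \<mu> * (a * b * (1 + s\<^sup>2))"
      using \<mu>(1) ab mult_right_mono[of 1 \<mu> "a * b * (1 + s\<^sup>2)"] by simp
    finally show False by simp
  qed
  then show knz: "k z \<noteq> 0" by (rule hk)
  then have "1 + z * deriv k z / k z = ((k z + z * deriv k z) * cnj (k z)) / of_real ((norm (k z))\<^sup>2)"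
    unfolding complex_norm_square by (simp add: field_simps)
  then have "Re (1 + z * deriv k z / k z) = h z / (norm (k z))\<^sup>2"
    by (simp only: Re_divide_of_real h_def)
  then show "Re (1 + z * deriv k z / k z) > 0"
    using \<open>h z > 0\<close> knz by simp
qed

subsection \<open>Superordination by a convex function\<close>

text \<open>For \<open>k = (G - G 0) / z\<close> one has \<open>G' = k + z k'\<close>, which is the
  case \<open>a = 0\<close>, \<open>b = 1\<close>, \<open>\<gamma> = 0\<close> of the preceding
  lemma, and \<open>1 + z k' / k\<close> is the starlikeness quotient.\<close>

lemma convex_imp_starlike:
  assumes holG: "G holomorphic_on ball 0 1"
    and G1: "\<And>z. z \<in> ball 0 1 \<Longrightarrow> deriv G z \<noteq> 0"
    and convex: "\<And>z. z \<in> ball 0 1 \<Longrightarrow> Re (1 + z * deriv (deriv G) z / deriv G z) > 0"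
    and z: "z \<in> ball 0 1" "z \<noteq> 0"
  shows "G z \<noteq> G 0" and "Re (z * deriv G z / (G z - G 0)) > 0"
proof -
  define k where "k = (\<lambda>u. if u = 0 then deriv G 0 else (G u - G 0) / u)"
  have holk: "k holomorphic_on ball 0 1"
  proof (rule pole_theorem_open_0[where g = "\<lambda>u. G u - G 0" and a = 0])
    show "(\<lambda>u. G u - G 0) holomorphic_on ball 0 1" by (intro holomorphic_intros holG)
    show "k 0 = deriv (\<lambda>u. G u - G 0) 0"
      using holomorphic_on_imp_differentiable_at[OF holG open_ball, of 0]
      by (subst deriv_diff) (auto simp: k_def)
  qed (auto simp: k_def)
  have m: "deriv G u = k u + u * deriv k u" if u: "u \<in> ball 0 1" for u
  proof -
    have "((\<lambda>u. G 0 + u * k u) has_field_derivative k u + u * deriv k u) (at u)"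
      using holomorphic_derivI[OF holk open_ball u] by (auto intro!: derivative_eq_intros)
    moreover have "(\<lambda>u. G 0 + u * k u) = G" by (auto simp: k_def)
    ultimately show ?thesis by (simp add: DERIV_imp_deriv)
  qed
  have k: "k z \<noteq> 0" "Re (1 + z * deriv k z / k z) > 0"
    by (rule briot_bouquet_positive[OF holk, of 0 1 "deriv G" 0 z]; use m G1 convex z(1) in simp)+
  have "1 + z * deriv k z / k z = deriv G z / k z"
    unfolding m[OF z(1)] using k(1) by (simp add: field_simps)
  also have "\<dots> = z * deriv G z / (G z - G 0)" using z by (simp add: k_def)
  finally have "1 + z * deriv k z / k z = z * deriv G z / (G z - G 0)" .
  with k(2) show "Re (z * deriv G z / (G z - G 0)) > 0" by simp
  show "G z \<noteq> G 0" using k(1) z by (simp add: k_def)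
qed

section \<open>Univalence of a convex map and the equation attached to it\<close>

locale convex_map =
  fixes G :: "complex \<Rightarrow> complex" and d :: real
  assumes holG: "G holomorphic_on ball 0 1"
    and G1: "\<And>z. z \<in> ball 0 1 \<Longrightarrow> deriv G z \<noteq> 0"
    and convex: "\<And>z. z \<in> ball 0 1 \<Longrightarrow> Re (1 + z * deriv (deriv G) z / deriv G z) > 0"
    and d: "d > 0"
begin

lemma starlike:
  assumes "z \<in> ball 0 1" "z \<noteq> 0"
  shows "G z \<noteq> G 0" "Re (z * deriv G z / (G z - G 0)) > 0"
  using convex_imp_starlike[OF holG G1 convex assms] by auto

text \<open>By starlikeness, \<open>radial_quotient\<close> applies to the preimages of the ray from
  \<open>G 0\<close> through the common value; uniqueness at parameter 1 identifies the two
  points.\<close>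

lemma inj_G: "inj_on G (ball 0 1)"
proof (rule inj_onI)
  fix z1 z2 assume z: "z1 \<in> ball 0 1" "z2 \<in> ball 0 1" and eq: "G z1 = G z2"
  show "z1 = z2"
  proof (cases "G z1 = G 0")
    case True
    then show ?thesis using starlike(1)[OF z(1)] starlike(1)[OF z(2)] eq by metis
  next
    case False
    define p where "p = G z1 - G 0"
    have dG: "deriv (\<lambda>z. G z - G 0) z = deriv G z" if "z \<in> ball 0 1" for z
      using holomorphic_on_imp_differentiable_at[OF holG open_ball that] by (subst deriv_diff) auto
    interpret radial_quotient "\<lambda>z. G z - G 0" "\<lambda>_. p"
    proof
      show "(\<lambda>z. G z - G 0) holomorphic_on ball 0 1" by (intro holomorphic_intros holG)
      fix z :: complex and s :: real
      assume z: "z \<in> ball 0 1" "s > 0" "G z - G 0 = of_real s * p"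
      then have "z \<noteq> 0" using False by (auto simp: p_def)
      then show "Re (z * (deriv (\<lambda>z. G z - G 0) z - of_real s * deriv (\<lambda>_. p) z) / (G z - G 0)) > 0"
        using starlike(2)[OF z(1)] dG[OF z(1)] by simp
    qed (use False G1 starlike(1) in \<open>auto simp: p_def dG\<close>)
    show ?thesis
      by (rule solution_unique[of _ _ 1]) (use z eq in \<open>auto simp: p_def\<close>)
  qed
qed

text \<open>At a solution the quotient in \<open>pos\<close> simplifies to
  \<open>(1 + z G'' / G') + s / d\<close>, whose first summand has positive real part by
  convexity.\<close>

lemma radial_quotient_Phi:
  assumes p: "p \<noteq> G 0"
  shows "radial_quotient (\<lambda>z. of_real d * (z * deriv G z)) (\<lambda>z. p - G z)"
proof -
  have dA: "deriv (\<lambda>z. of_real d * (z * deriv G z)) z = of_real d * (deriv G z + z * deriv (deriv G) z)"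
    if "z \<in> ball 0 1" for z
    by (rule DERIV_imp_deriv)
       (use holomorphic_derivI[OF holomorphic_deriv[OF holG open_ball] open_ball that] in
         \<open>auto intro!: derivative_eq_intros\<close>)
  have dB: "deriv (\<lambda>z. p - G z) z = - deriv G z" if "z \<in> ball 0 1" for z
    by (rule DERIV_imp_deriv)
       (use holomorphic_derivI[OF holG open_ball that] in \<open>auto intro!: derivative_eq_intros\<close>)
  show ?thesis
  proof
    show "(\<lambda>z. of_real d * (z * deriv G z)) holomorphic_on ball 0 1"
      by (intro holomorphic_intros holomorphic_deriv holG open_ball)
    show "(\<lambda>z. p - G z) holomorphic_on ball 0 1" by (intro holomorphic_intros holG)
    fix z :: complex and s :: real
    assume z: "z \<in> ball 0 1" and s: "s > 0" and eq: "of_real d * (z * deriv G z) = of_real s * (p - G z)"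
    have nz: "z \<noteq> 0" using eq s p by auto
    have "z * (deriv (\<lambda>z. of_real d * (z * deriv G z)) z - of_real s * deriv (\<lambda>z. p - G z) z)
          / (of_real d * (z * deriv G z))
        = (1 + z * deriv (deriv G) z / deriv G z) + of_real (s / d)"
    proof -
      have "x * (d' * (g + x * g') - s' * - g) / (d' * (x * g)) = (1 + x * g' / g) + s' / d'"
        if "x \<noteq> 0" "g \<noteq> 0" "d' \<noteq> 0" for x d' g g' s' :: complex
        using that by (simp add: field_simps)
      from this[OF nz G1[OF z], of "of_real d"] show ?thesis
        using d by (simp only: dA[OF z] dB[OF z] of_real_divide) simp
    qed
    then show "Re (z * (deriv (\<lambda>z. of_real d * (z * deriv G z)) z - of_real s * deriv (\<lambda>z. p - G z) z)
          / (of_real d * (z * deriv G z))) > 0"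
      using convex[OF z] s d by (simp add: add_pos_pos)
  qed (use G1 d p in \<open>auto simp: dA\<close>)
qed

section \<open>The map \<open>Phi\<close>: univalence, and passage from superordination to
  subordination\<close>

definition Phi :: "complex \<Rightarrow> complex" where
  "Phi z = G z + of_real d * (z * deriv G z)"

lemma hol_Phi: "Phi holomorphic_on ball 0 1"
  unfolding Phi_def[abs_def] by (intro holomorphic_intros holomorphic_deriv holG open_ball)

text \<open>Covers the value \<open>p = G 0\<close> excluded in \<open>radial_quotient_Phi\<close>:
  at another preimage the starlikeness quotient would be the negative number
  \<open>-1 / d\<close>.\<close>

lemma Phi_eq_G0:
  assumes "z \<in> ball 0 1" "Phi z = G 0"
  shows "z = 0"
proof (rule ccontr)
  assume nz: "z \<noteq> 0"
  have ne: "G z - G 0 \<noteq> 0" using starlike(1)[OF assms(1) nz] by simp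
  have "of_real d * (z * deriv G z) = - (G z - G 0)" using assms(2) by (simp add: Phi_def algebra_simps)
  then have "z * deriv G z / (G z - G 0) = - of_real (1 / d)" using ne d by (simp add: field_simps)
  then show False using starlike(2)[OF assms(1) nz] d by simp
qed

lemma inj_Phi: "inj_on Phi (ball 0 1)"
proof (rule inj_onI)
  fix z1 z2 assume z: "z1 \<in> ball 0 1" "z2 \<in> ball 0 1" and eq: "Phi z1 = Phi z2"
  show "z1 = z2"
  proof (cases "Phi z1 = G 0")
    case True
    then show ?thesis using Phi_eq_G0 z eq by metis
  next
    case False
    then interpret radial_quotient "\<lambda>z. of_real d * (z * deriv G z)" "\<lambda>z. Phi z1 - G z"
      by (rule radial_quotient_Phi)
    show ?thesis
      by (rule solution_unique[of _ _ 1]) (use z eq in \<open>auto simp: Phi_def algebra_simps\<close>)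
  qed
qed

text \<open>Calling the given value \<open>p\<close>, the point \<open>z0\<close> solves
  \<open>d z G' = s * (p - G z)\<close> with \<open>s = 1 / t \<ge> 1\<close>. Descending to
  \<open>s = 1\<close> gives a preimage of \<open>p\<close> under \<open>Phi\<close> without
  increasing the modulus.\<close>

lemma chain_in_Phi:
  assumes z0: "z0 \<in> ball 0 1" and t: "0 < t" "t \<le> 1"
  shows "G z0 + of_real (t * d) * (z0 * deriv G z0) \<in> Phi ` cball 0 (norm z0)"
proof -
  define p where "p = G z0 + of_real (t * d) * (z0 * deriv G z0)"
  show ?thesis
  proof (cases "p = G 0")
    case True
    then have "p = Phi 0" by (simp add: Phi_def)
    then show ?thesis by (auto simp: p_def)
  next
    case False
    then interpret radial_quotient "\<lambda>z. of_real d * (z * deriv G z)" "\<lambda>z. p - G z"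
      by (rule radial_quotient_Phi)
    have "of_real d * (z0 * deriv G z0) = of_real (1 / t) * (p - G z0)"
      using t by (simp add: p_def field_simps)
    then obtain z where "norm z \<le> norm z0" "of_real d * (z * deriv G z) = of_real 1 * (p - G z)"
      using exists_descent[OF z0, of "1 / t" 1] t by (auto simp: divide_simps)
    then have "p = Phi z" "z \<in> cball 0 (norm z0)" by (auto simp: Phi_def algebra_simps)
    then show ?thesis by (auto simp: p_def)
  qed
qed

text \<open>The subordinating function is \<open>R \<circ> G\<close> with \<open>R\<close> the
  inverse of \<open>P\<close>. The bound on its modulus comes from showing, for every
  \<open>\<rho>\<close> with \<open>norm z < \<rho> < 1\<close>, that \<open>G z\<close> lies in the
  image under \<open>P\<close> of the disc of radius \<open>\<rho>\<close>.\<close>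

lemma subordinate_of_superordination:
  assumes holP: "P holomorphic_on ball 0 1" and injP: "inj_on P (ball 0 1)"
    and injH: "inj_on (\<lambda>z. P z + of_real d * (z * deriv P z)) (ball 0 1)"
    and omega: "\<And>z. z \<in> ball 0 1 \<Longrightarrow> norm (\<omega> z) \<le> norm z"
      "\<And>z. z \<in> ball 0 1 \<Longrightarrow> Phi z = P (\<omega> z) + of_real d * (\<omega> z * deriv P (\<omega> z))"
  shows "G \<prec>\<^sub>s P"
proof -
  define H where "H = (\<lambda>z. P z + of_real d * (z * deriv P z))"
  have GP0: "G 0 = P 0" using omega[of 0] by (simp add: Phi_def)
  obtain R where R: "R holomorphic_on P ` ball 0 1"
    "\<And>z. z \<in> ball 0 1 \<Longrightarrow> R (P z) = z"
    using holomorphic_has_inverse[OF holP open_ball injP] by metis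
  have openP: "open (P ` ball 0 r)" if "r \<le> 1" for r
    using that by (intro open_mapping_thm3 holomorphic_on_subset[OF holP] inj_on_subset[OF injP]) auto
  have key: "G z \<in> P ` ball 0 \<rho>" if z: "norm z < \<rho>" "\<rho> < 1" for z \<rho>
  proof (rule ccontr)
    assume bad: "G z \<notin> P ` ball 0 \<rho>"
    \<comment> \<open>A point \<open>z0\<close> of \<open>X\<close> of least modulus is where
      \<open>G\<close> first leaves the image of the \<open>\<rho>\<close>-disc.\<close>
    define X where "X = {u \<in> cball 0 (norm z). G u \<in> - P ` ball 0 \<rho>}"
    have "cball 0 (norm z) \<subseteq> ball 0 1" using z by auto
    then have "continuous_on (cball 0 (norm z)) G"
      using holG holomorphic_on_imp_continuous_on holomorphic_on_subset by blast
    then have "closed (cball 0 (norm z) \<inter> G -` (- P ` ball 0 \<rho>))"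
      using openP[of \<rho>] z by (intro continuous_closed_preimage) auto
    then have "closed X" by (simp add: X_def vimage_def Int_def)
    moreover have "bounded X" by (rule bounded_subset[OF bounded_cball[of 0 "norm z"]]) (auto simp: X_def)
    ultimately have "compact X" by (simp add: compact_eq_bounded_closed)
    moreover have "z \<in> X" using bad by (simp add: X_def)
    ultimately obtain z0 where z0: "z0 \<in> X" "\<And>u. u \<in> X \<Longrightarrow> norm z0 \<le> norm u"
      using continuous_attains_inf[of X norm] continuous_on_norm_id by blast
    have z0r: "norm z0 < \<rho>" "norm z0 < 1" "G z0 \<notin> P ` ball 0 \<rho>" using z0(1) z by (auto simp: X_def)
    have "P 0 \<in> P ` ball 0 \<rho>" using z norm_ge_zero[of z] by (intro imageI) (simp del: norm_ge_zero)
    then have z0nz: "z0 \<noteq> 0" using z0r(3) GP0 by auto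
    have inside: "G u \<in> P ` ball 0 \<rho>" if "norm u < norm z0" for u
      using z0(2)[of u] z0(1) that by (force simp: X_def)
    have "compact (P ` cball 0 \<rho>)"
      using z by (intro compact_continuous_image holomorphic_on_imp_continuous_on holomorphic_on_subset[OF holP]) auto
    then have clP: "closed (P ` cball 0 \<rho>)" by (rule compact_imp_closed)
    have contG: "continuous_on (closure (ball 0 (norm z0))) G"
      using z0r z0nz by (intro holomorphic_on_imp_continuous_on holomorphic_on_subset[OF holG]) auto
    have "P ` ball 0 \<rho> \<subseteq> P ` cball 0 \<rho>" by (intro image_mono) auto
    then have "G ` ball 0 (norm z0) \<subseteq> P ` cball 0 \<rho>" using inside by auto
    then have "G ` closure (ball 0 (norm z0)) \<subseteq> P ` cball 0 \<rho>"
      by (rule image_closure_subset[OF contG clP])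
    then have clos: "G u \<in> P ` cball 0 \<rho>" if "norm u \<le> norm z0" for u
      using that z0nz by auto
    define S where "S = ball 0 1 \<inter> G -` (P ` ball 0 1)"
    have S: "open S" unfolding S_def
      by (intro continuous_open_preimage holomorphic_on_imp_continuous_on[OF holG] open_ball openP) simp
    have "P ` cball 0 \<rho> \<subseteq> P ` ball 0 1" using z by (intro image_mono) auto
    then have "u \<in> S" if "norm u \<le> norm z0" for u
      using subsetD[OF _ clos[OF that]] that z0r(2) by (simp add: S_def)
    then have cS: "cball 0 (norm z0) \<subseteq> S" by auto
    define w where "w = (\<lambda>u. R (G u))"
    have holGS: "G holomorphic_on S" using holG by (rule holomorphic_on_subset) (auto simp: S_def)
    have holw: "w holomorphic_on S"
      using holomorphic_on_compose_gen[OF holGS R(1)] by (auto simp: S_def w_def o_def)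
    have Pw: "P (w u) = G u" "w u \<in> ball 0 1" if "u \<in> S" for u
      using that R(2) by (auto simp: S_def w_def)
    have wle: "norm (w u) \<le> \<rho>" if u: "norm u \<le> norm z0" for u
    proof -
      obtain y where y: "y \<in> cball 0 \<rho>" "G u = P y" using clos[OF u] by auto
      then have "w u = y" using R(2)[of y] z by (simp add: w_def)
      with y show ?thesis by simp
    qed
    have z0S: "z0 \<in> S" using cS by auto
    have "\<not> norm (w z0) < \<rho>" using Pw[OF z0S] z0r(3) by (metis imageI mem_ball_0)
    then have wz0: "norm (w z0) = \<rho>" using wle[of z0] by simp
    have "w 0 = 0" using R(2)[of 0] by (simp add: w_def GP0)
    moreover have "w z0 \<noteq> 0" using wz0 z norm_ge_zero[of z] by auto
    ultimately obtain m :: real where m: "m \<ge> 1" "z0 * deriv w z0 = of_real m * w z0"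
      using Jack_lemma[OF holw S cS _ z0nz] wle wz0 by metis
    have "(P has_field_derivative deriv P (w z0)) (at (w z0))"
      using holomorphic_derivI[OF holP open_ball] Pw(2)[OF z0S] by blast
    from DERIV_chain2[OF this holomorphic_derivI[OF holw S z0S]]
    have "((\<lambda>u. P (w u)) has_field_derivative deriv P (w z0) * deriv w z0) (at z0)" .
    then have "(G has_field_derivative deriv P (w z0) * deriv w z0) (at z0)"
      by (rule has_field_derivative_transform_within_open[OF _ S z0S]) (simp add: Pw)
    then have "deriv G z0 = deriv P (w z0) * deriv w z0" by (rule DERIV_imp_deriv)
    then have "z0 * deriv G z0 = deriv P (w z0) * (z0 * deriv w z0)" by simp
    also have "\<dots> = of_real m * (w z0 * deriv P (w z0))" by (simp add: m(2))
    finally have "w z0 * deriv P (w z0) = of_real (1 / m) * (z0 * deriv G z0)" using m(1) by (simp add: field_simps)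
    then have "H (w z0) = G z0 + of_real (1 / m * d) * (z0 * deriv G z0)"
      by (simp add: H_def Pw(1)[OF z0S])
    also have "\<dots> \<in> Phi ` cball 0 (norm z0)"
      using chain_in_Phi[of z0 "1 / m"] m(1) z0r by simp
    finally obtain u where u: "norm u \<le> norm z0" "H (w z0) = Phi u" by auto
    have ub: "u \<in> ball 0 1" using u z0r by simp
    \<comment> \<open>Injectivity of \<open>H\<close> would force \<open>w z0 = \<omega> u\<close>,
      but \<open>norm (\<omega> u) \<le> norm u \<le> norm z0 < \<rho> = norm (w
      z0)\<close>.\<close>
    have "H (w z0) = H (\<omega> u)" using omega(2)[OF ub] u(2) by (simp add: H_def)
    moreover have "\<omega> u \<in> ball 0 1" using omega(1)[OF ub] ub by simp
    ultimately have "w z0 = \<omega> u" using injH Pw(2)[OF z0S] unfolding H_def by (metis inj_onD)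
    then show False using omega(1)[OF ub] u(1) wz0 z0r by simp
  qed
  \<comment> \<open>Let \<open>\<rho>\<close> decrease to \<open>norm z\<close>.\<close>
  have norm_R: "norm (R (G z)) \<le> norm z" "P (R (G z)) = G z" "G z \<in> P ` ball 0 1" if z: "z \<in> ball 0 1" for z
  proof -
    have *: "norm (R (G z)) < \<rho> \<and> P (R (G z)) = G z \<and> G z \<in> P ` ball 0 1"
      if \<rho>: "norm z < \<rho>" "\<rho> < 1" for \<rho>
    proof -
      obtain y where "y \<in> ball 0 \<rho>" "G z = P y" using key[OF \<rho>] by auto
      then show ?thesis using R(2)[of y] \<rho> by auto
    qed
    have z1: "norm z < 1" using z by simp
    have "norm (R (G z)) \<le> \<rho>" if "norm z < \<rho>" for \<rho>
    proof (cases "\<rho> < 1")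
      case True then show ?thesis using *[OF that] by auto
    next
      case False
      obtain \<sigma> where "norm z < \<sigma>" "\<sigma> < 1" using dense[OF z1] by auto
      then show ?thesis using *[of \<sigma>] False by simp
    qed
    then show "norm (R (G z)) \<le> norm z" by (rule dense_ge)
    obtain \<sigma> where "norm z < \<sigma>" "\<sigma> < 1" using dense[OF z1] by auto
    then show "P (R (G z)) = G z" "G z \<in> P ` ball 0 1" using * by auto
  qed
  have "G ` ball 0 1 \<subseteq> P ` ball 0 1" using norm_R(3) by blast
  then have "(\<lambda>z. R (G z)) holomorphic_on ball 0 1"
    using holomorphic_on_compose_gen[OF holG R(1)] by (simp add: o_def)
  then show ?thesis
    unfolding subordinate_def using holG holP norm_R by (intro conjI exI[of _ "\<lambda>z. R (G z)"]) auto
qed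

lemma univalent_G: "univalent G"
  and univalent_Phi: "univalent Phi"
  by (auto simp: univalent_def holG inj_G hol_Phi inj_Phi)

text \<open>\<open>G\<close> itself solves the superordination, with the identity as subordinating
  function, so every subordinant is subordinate to \<open>G\<close>. That \<open>G\<close> is a
  subordinant is the preceding lemma.\<close>

lemma best_subordinant_G:
  assumes \<Phi>: "\<And>z. z \<in> ball 0 1 \<Longrightarrow> \<Phi> z = Phi z"
  shows "best_subordinant (\<lambda>u v. u + of_real d * v) \<Phi> G"
proof -
  have hol: "\<Phi> holomorphic_on ball 0 1"
    using hol_Phi by (rule holomorphic_transform) (simp add: \<Phi>)
  have "Phi = (\<lambda>z. G z + of_real d * (z * deriv G z))" by (auto simp: Phi_def)
  then have "superord_solution (\<lambda>u v. u + of_real d * v) \<Phi> G"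
    unfolding superord_solution_def subordinate_def
    using univalent_G univalent_Phi hol hol_Phi \<Phi>
    by (auto intro!: exI[of _ "\<lambda>z. z"] holomorphic_intros)
  moreover have "G \<prec>\<^sub>s P" if P: "superord_solution (\<lambda>u v. u + of_real d * v) \<Phi> P" for P
  proof -
    obtain \<omega> where \<omega>: "\<And>z. z \<in> ball 0 1 \<Longrightarrow> norm (\<omega> z) \<le> norm z"
      "\<And>z. z \<in> ball 0 1 \<Longrightarrow> \<Phi> z = P (\<omega> z) + of_real d * (\<omega> z * deriv P (\<omega> z))"
      using P unfolding superord_solution_def subordinate_def by blast
    show ?thesis
      by (rule subordinate_of_superordination[of P \<omega>])
        (use P \<omega> \<Phi> in \<open>simp_all add: superord_solution_def univalent_def\<close>)
  qed
  ultimately show ?thesis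
    unfolding best_subordinant_def subordinant_def using univalent_G holG by blast
qed

end

subsection \<open>The operator \<open>B\<close>\<close>

text \<open>The Taylor series at 0 of \<open>B_quot\<close>, for real parameter. Division by
  \<open>z\<close> shifts the index, so the coefficient of order \<open>n\<close> involves the
  Taylor coefficient of \<open>f\<close> of order \<open>Suc n\<close>.\<close>

definition B_fps :: "real \<Rightarrow> complex \<Rightarrow> (complex \<Rightarrow> complex) \<Rightarrow> complex fps" where
  "B_fps \<nu> c f = Abs_fps (\<lambda>n. taylor_coeff f (Suc n) *
     ((- c / 4) ^ n / (pochhammer (of_real \<nu>) n * fact n)))"

text \<open>The ratio test even gives summability: successive terms have ratio
  \<open>norm x / ((\<nu> + n) * (n + 1))\<close>, eventually at most 1/2.\<close>

lemma bessel_coeffs_bounded: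
  assumes "\<nu> > 0"
  shows "Bseq (\<lambda>n. x ^ n / (pochhammer (of_real \<nu>) n * fact n) :: complex)"
proof -
  \<comment> \<open>The added 1 ensures \<open>\<nu> + n \<ge> 1\<close> for
    \<open>n \<ge> N\<close>.\<close>
  define N where "N = nat \<lceil>2 * norm x\<rceil> + 1"
  have N: "real N \<ge> 2 * norm x" "N \<ge> 1" unfolding N_def by linarith+
  have "summable (\<lambda>n. x ^ n / (pochhammer (of_real \<nu>) n * fact n) :: complex)"
  proof (rule summable_ratio_test[of "1/2" N])
    fix n assume n: "n \<ge> N"
    define t where "t = x ^ n / (pochhammer (of_real \<nu>) n * fact n)"
    have nn: "norm (of_real \<nu> + of_nat n :: complex) = \<nu> + real n"
    proof -
      have "(of_real \<nu> + of_nat n :: complex) = of_real (\<nu> + real n)" by simp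
      then show ?thesis using assms by (simp only: norm_of_real)
    qed
    have "2 * norm x \<le> 1 * real (Suc n)" using n N by simp
    also have "\<dots> \<le> (\<nu> + real n) * real (Suc n)" using n N assms by (intro mult_right_mono) auto
    finally have le: "norm x / ((\<nu> + real n) * real (Suc n)) \<le> 1/2"
      using assms n N by (subst pos_divide_le_eq) (auto intro!: mult_pos_pos add_pos_nonneg)
    have "x ^ Suc n / (pochhammer (of_real \<nu>) (Suc n) * fact (Suc n))
        = t * (x / ((of_real \<nu> + of_nat n) * of_nat (Suc n)))"
      by (simp add: t_def pochhammer_Suc mult_ac)
    also have "norm \<dots> = norm t * (norm x / ((\<nu> + real n) * real (Suc n)))"
      by (simp only: norm_mult norm_divide nn norm_of_nat)
    also have "\<dots> \<le> norm t * (1/2)" using le by (intro mult_left_mono) auto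
    finally show "norm (x ^ Suc n / (pochhammer (of_real \<nu>) (Suc n) * fact (Suc n))) \<le> 1/2 * norm t"
      by simp
  qed simp
  then show ?thesis
    by (intro convergent_imp_Bseq convergentI[OF summable_LIMSEQ_zero])
qed

text \<open>The coefficients are those of \<open>f\<close>, shifted by one and multiplied by a
  bounded sequence; neither operation makes the radius smaller than 1.\<close>

lemma B_fps_conv_radius:
  assumes f: "f holomorphic_on ball 0 1" and \<nu>: "\<nu> > 0"
  shows "fps_conv_radius (B_fps \<nu> c f) \<ge> 1"
  unfolding fps_conv_radius_def
proof (rule conv_radius_geI_ex')
  fix r :: real assume r: "0 < r" "ereal r < 1"
  obtain C where C: "\<And>n. norm ((- c / 4) ^ n / (pochhammer (of_real \<nu>) n * fact n) :: complex) \<le> C"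
    using bessel_coeffs_bounded[OF \<nu>, of "- c / 4"] unfolding Bseq_def by blast
  have "f holomorphic_on eball 0 1" using f by (simp add: one_ereal_def)
  from conv_radius_fps_expansion[OF this]
  have "1 \<le> conv_radius (taylor_coeff f)"
    by (simp add: fps_conv_radius_def fps_expansion_def taylor_coeff_def[abs_def])
  with r(2) have "ereal r < conv_radius (taylor_coeff f)" by (rule less_le_trans)
  then have "summable (\<lambda>n. norm (taylor_coeff f n * of_real r ^ n))"
    using r by (intro abs_summable_in_conv_radius) auto
  then have "summable (\<lambda>n. norm (taylor_coeff f (Suc n) * of_real r ^ Suc n))"
    by (subst summable_Suc_iff)
  \<comment> \<open>Dividing by \<open>r\<close> compensates for the index shift.\<close>
  then have "summable (\<lambda>n. C / r * norm (taylor_coeff f (Suc n) * of_real r ^ Suc n))"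
    by (rule summable_mult)
  then show "summable (\<lambda>n. fps_nth (B_fps \<nu> c f) n * of_real r ^ n)"
  proof (rule summable_comparison_test'[where N = 0])
    fix n
    have "norm (fps_nth (B_fps \<nu> c f) n * of_real r ^ n) =
        norm (taylor_coeff f (Suc n)) * r ^ n * norm ((- c / 4) ^ n / (pochhammer (of_real \<nu>) n * fact n))"
      using r by (simp add: B_fps_def norm_mult norm_divide norm_power)
    also have "\<dots> \<le> norm (taylor_coeff f (Suc n)) * r ^ n * C"
      using r by (intro mult_left_mono C) auto
    also have "\<dots> = C / r * norm (taylor_coeff f (Suc n) * of_real r ^ Suc n)"
      using r by (simp add: norm_mult norm_power)
    finally show "norm (fps_nth (B_fps \<nu> c f) n * of_real r ^ n)
        \<le> C / r * norm (taylor_coeff f (Suc n) * of_real r ^ Suc n)" .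
  qed
qed

lemma less_B_fps_conv_radius:
  assumes "f holomorphic_on ball 0 1" "\<nu> > 0" "z \<in> ball 0 1"
  shows "ereal (norm z) < fps_conv_radius (B_fps \<nu> c f)"
proof -
  have "ereal (norm z) < 1" using assms(3) by simp
  also note B_fps_conv_radius[OF assms(1,2)]
  finally show ?thesis .
qed

lemma B_quot_eq_eval_fps:
  assumes f: "f holomorphic_on ball 0 1" "deriv f 0 = 1" and \<nu>: "\<nu> > 0" and z: "z \<in> ball 0 1"
  shows "B_quot (of_real \<nu>) c f z = eval_fps (B_fps \<nu> c f) z"
proof -
  have nth0: "fps_nth (B_fps \<nu> c f) 0 = 1" by (simp add: B_fps_def taylor_coeff_def f)
  show ?thesis
  proof (cases "z = 0")
    case True
    then show ?thesis by (simp add: B_quot_def eval_fps_at_0 nth0)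
  next
    case False
    have "ereal (norm z) < fps_conv_radius (B_fps \<nu> c f)"
      using less_B_fps_conv_radius[OF f(1) \<nu> z] .
    then have sum: "summable (\<lambda>n. fps_nth (B_fps \<nu> c f) n * z ^ n)"
      by (rule summable_fps)
    then have sum': "summable (\<lambda>n. fps_nth (B_fps \<nu> c f) (Suc n) * z ^ Suc n)"
      by (subst summable_Suc_iff)
    have "eval_fps (B_fps \<nu> c f) z = 1 + (\<Sum>n. fps_nth (B_fps \<nu> c f) (Suc n) * z ^ Suc n)"
      using suminf_split_head[OF sum] by (simp add: eval_fps_def nth0)
    moreover have "taylor_coeff f (Suc n + 1) * ((- c / 4) ^ Suc n / pochhammer (of_real \<nu>) (Suc n)) *
        (z ^ (Suc n + 1) / fact (Suc n)) = z * (fps_nth (B_fps \<nu> c f) (Suc n) * z ^ Suc n)" for n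
    proof -
      have "t * (x / p) * (z ^ (Suc n + 1) / q) = z * (t * (x / (p * q)) * z ^ Suc n)" for t x p q
        by simp
      then show ?thesis by (simp only: B_fps_def fps_nth_Abs_fps Suc_eq_plus1)
    qed
    then have "B_op (of_real \<nu>) c f z = z + (\<Sum>n. z * (fps_nth (B_fps \<nu> c f) (Suc n) * z ^ Suc n))"
      unfolding B_op_def by (simp only:)
    moreover have "(\<Sum>n. z * (fps_nth (B_fps \<nu> c f) (Suc n) * z ^ Suc n)) =
        z * (\<Sum>n. fps_nth (B_fps \<nu> c f) (Suc n) * z ^ Suc n)"
      by (rule suminf_mult[OF sum'])
    ultimately show ?thesis using False by (simp add: B_quot_def add_divide_distrib)
  qed
qed

text \<open>Coefficientwise this is \<open>1 / (\<nu>)_n = (1 + n / \<nu>) / (\<nu> + 1)_n\<close>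
  for Pochhammer symbols, since \<open>X * d/dX\<close> multiplies the coefficient of order
  \<open>n\<close> by \<open>n\<close>.\<close>

lemma B_fps_recurrence:
  assumes "\<nu> > 0"
  shows "B_fps \<nu> c f = B_fps (\<nu> + 1) c f + fps_const (of_real (1 / \<nu>)) * (fps_X * fps_deriv (B_fps (\<nu> + 1) c f))"
proof (rule fps_ext)
  fix n
  define a :: complex where "a = of_real \<nu>"
  have pos: "pochhammer a n \<noteq> 0" "pochhammer (a + 1) n \<noteq> 0" "a \<noteq> 0"
  proof -
    have "pochhammer a n = of_real (pochhammer \<nu> n)" "pochhammer (a + 1) n = of_real (pochhammer (\<nu> + 1) n)"
      by (simp_all add: a_def pochhammer_of_real[symmetric])
    moreover have "pochhammer \<nu> n > 0" "pochhammer (\<nu> + 1) n > 0" using assms by (auto intro: pochhammer_pos)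
    ultimately show "pochhammer a n \<noteq> 0" "pochhammer (a + 1) n \<noteq> 0" "a \<noteq> 0" using assms by (auto simp: a_def)
  qed
  have "pochhammer a n * (a + of_nat n) = a * pochhammer (a + 1) n"
    using pochhammer_rec[of a n] by (simp add: pochhammer_Suc)
  then have eq: "1 / pochhammer a n = (1 + of_nat n / a) / pochhammer (a + 1) n"
    using pos by (simp add: divide_simps) (simp add: algebra_simps)
  have X: "fps_nth (fps_X * fps_deriv F) n = of_nat n * fps_nth F n" for F :: "complex fps"
    by (cases n) auto
  define T where "T = taylor_coeff f (Suc n) * (- c / 4) ^ n / fact n"
  have "fps_nth (B_fps \<nu> c f) n = T * (1 / pochhammer a n)"
    by (simp add: B_fps_def T_def a_def)
  also have "\<dots> = T / pochhammer (a + 1) n + of_real (1 / \<nu>) * (of_nat n * (T / pochhammer (a + 1) n))"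
    unfolding eq using pos by (simp add: a_def field_simps)
  also have "T / pochhammer (a + 1) n = fps_nth (B_fps (\<nu> + 1) c f) n"
    by (simp add: B_fps_def T_def a_def)
  finally show "fps_nth (B_fps \<nu> c f) n =
      fps_nth (B_fps (\<nu> + 1) c f + fps_const (of_real (1 / \<nu>)) * (fps_X * fps_deriv (B_fps (\<nu> + 1) c f))) n"
    by (simp add: X)
qed

section \<open>From power series to functions on the disc\<close>

lemma B_quot_holomorphic:
  assumes "f holomorphic_on ball 0 1" "deriv f 0 = 1" "\<nu> > 0"
  shows "B_quot (of_real \<nu>) c f holomorphic_on ball 0 1"
proof -
  have "eval_fps (B_fps \<nu> c f) holomorphic_on ball 0 1"
    by (intro holomorphic_on_eval_fps subsetI) (simp add: in_eball_iff less_B_fps_conv_radius[OF assms(1,3)])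
  then show ?thesis
    by (rule holomorphic_transform) (simp add: B_quot_eq_eval_fps assms)
qed

lemma B_quot_recurrence:
  assumes f: "f holomorphic_on ball 0 1" "deriv f 0 = 1" and \<nu>: "\<nu> > 0" and z: "z \<in> ball 0 1"
  shows "B_quot (of_real \<nu>) c f z = B_quot (of_real (\<nu> + 1)) c f z
      + of_real (1 / \<nu>) * (z * deriv (B_quot (of_real (\<nu> + 1)) c f) z)"
proof -
  define F where "F = B_fps (\<nu> + 1) c f"
  have R: "ereal (norm z) < fps_conv_radius F"
    unfolding F_def using \<nu> by (intro less_B_fps_conv_radius f z) simp
  then have R': "ereal (norm z) < fps_conv_radius (fps_deriv F)"
    using fps_conv_radius_deriv[of F] by (rule less_le_trans)
  have "fps_conv_radius (fps_deriv F) \<le> fps_conv_radius (fps_X * fps_deriv F)"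
    using fps_conv_radius_mult[of fps_X "fps_deriv F"] by simp
  with R' have RX: "ereal (norm z) < fps_conv_radius (fps_X * fps_deriv F)"
    by (rule less_le_trans)
  have "(eval_fps F has_field_derivative eval_fps (fps_deriv F) z) (at z)"
    using R by (rule has_field_derivative_eval_fps)
  then have "(B_quot (of_real (\<nu> + 1)) c f has_field_derivative eval_fps (fps_deriv F) z) (at z)"
    by (rule has_field_derivative_transform_within_open[OF _ open_ball z])
      (use \<nu> f in \<open>simp add: F_def B_quot_eq_eval_fps del: of_real_add\<close>)
  then have d: "deriv (B_quot (of_real (\<nu> + 1)) c f) z = eval_fps (fps_deriv F) z"
    by (rule DERIV_imp_deriv)
  have "B_quot (of_real \<nu>) c f z = eval_fps (F + fps_const (of_real (1 / \<nu>)) * (fps_X * fps_deriv F)) z"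
    by (simp only: B_quot_eq_eval_fps[OF f \<nu> z] B_fps_recurrence[OF \<nu>] F_def)
  also have "\<dots> = eval_fps F z + of_real (1 / \<nu>) * (z * eval_fps (fps_deriv F) z)"
    using R R' RX \<nu> by (simp add: eval_fps_add eval_fps_mult fps_conv_radius_cmult_left)
  finally show ?thesis
    using \<nu> by (simp only: d F_def B_quot_eq_eval_fps[OF f _ z] add_pos_pos zero_less_one)
qed

text \<open>The recurrence at \<open>\<nu> = \<kappa> + 1\<close> rewrites the first summand of
  \<open>B_mix\<close>; the undifferentiated terms then have weights \<open>1 - l\<close> and
  \<open>l\<close>, which add up to 1.\<close>

lemma B_mix_eq:
  assumes f: "f holomorphic_on ball 0 1" "deriv f 0 = 1" and \<kappa>: "\<kappa> > -1" and z: "z \<in> ball 0 1"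
  shows "B_mix l \<kappa> c f z = B_quot (of_real (\<kappa> + 2)) c f z
      + of_real ((1 - l) / (\<kappa> + 1)) * (z * deriv (B_quot (of_real (\<kappa> + 2)) c f) z)"
proof -
  have e: "\<kappa> + 1 + 1 = \<kappa> + 2" by simp
  have "B_quot (of_real (\<kappa> + 1)) c f z = B_quot (of_real (\<kappa> + 2)) c f z
      + of_real (1 / (\<kappa> + 1)) * (z * deriv (B_quot (of_real (\<kappa> + 2)) c f) z)"
    using B_quot_recurrence[OF f, of "\<kappa> + 1" z c] \<kappa> z unfolding e by simp
  then show ?thesis unfolding B_mix_def
    by (simp only: of_real_diff of_real_1 of_real_divide) (simp add: algebra_simps)
qed

text \<open>This is the condition on \<open>\<gamma>\<close> in
  \<open>briot_bouquet_positive\<close> for \<open>a = 1\<close>, \<open>b = d\<close>. The square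
  root dominates both \<open>u\<^sup>2\<close> and \<open>v\<^sup>2\<close>, so \<open>w\<close> is
  at most either square, and the inequality holds separately for the constant term and for the
  coefficient of \<open>s\<^sup>2\<close>.\<close>

lemma gamma_const_bound:
  assumes "l < 1" "\<kappa> > -1"
  defines "d \<equiv> (1 - l) / (\<kappa> + 1)"
  shows "2 * gamma_const l \<kappa> * (1\<^sup>2 + d\<^sup>2 * s\<^sup>2) \<le> 1 * d * (1 + s\<^sup>2)"
proof -
  define u v where "u = 1 - l" and "v = \<kappa> + 1"
  have uv: "u > 0" "v > 0" using assms by (auto simp: u_def v_def)
  define w where "w = u\<^sup>2 + v\<^sup>2 - sqrt (u ^ 4 + v ^ 4)"
  have "u\<^sup>2 \<le> sqrt (u ^ 4 + v ^ 4)" "v\<^sup>2 \<le> sqrt (u ^ 4 + v ^ 4)"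
    by (auto intro!: real_le_rsqrt simp flip: power_mult)
  then have w: "w \<le> v\<^sup>2" "w \<le> u\<^sup>2" by (auto simp: w_def)
  have g: "gamma_const l \<kappa> = w / (4 * u * v)"
    by (simp add: gamma_const_def w_def u_def v_def)
  have d: "d = u / v" by (simp add: d_def u_def v_def)
  have 1: "2 * gamma_const l \<kappa> \<le> d"
  proof -
    have "w \<le> 2 * u\<^sup>2" using w(2) zero_le_power2[of u] by linarith
    then have "w * v \<le> 2 * u\<^sup>2 * v" using uv by (intro mult_right_mono) auto
    then show ?thesis unfolding g d using uv by (simp add: field_simps power2_eq_square)
  qed
  have 2: "2 * gamma_const l \<kappa> * d\<^sup>2 \<le> d"
  proof -
    have "w \<le> 2 * v\<^sup>2" using w(1) zero_le_power2[of v] by linarith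
    then have "w * u \<le> 2 * v\<^sup>2 * u" using uv by (intro mult_right_mono) auto
    then show ?thesis unfolding g d using uv by (simp add: field_simps power2_eq_square)
  qed
  have "2 * gamma_const l \<kappa> + (2 * gamma_const l \<kappa> * d\<^sup>2) * s\<^sup>2 \<le> d + d * s\<^sup>2"
    using 1 2 by (intro add_mono mult_right_mono) auto
  then show ?thesis by (simp add: algebra_simps)
qed

subsection \<open>The best subordinant\<close>

theorem theorem2:
  fixes f g \<Phi> :: "complex \<Rightarrow> complex" and p b \<kappa> l :: real and c :: complex
  assumes "f \<in> class_A" and "g \<in> class_A"
    and "\<kappa> = p + (b + 1) / 2" and "\<kappa> > -1"
    and "c \<noteq> 0"
    and "0 \<le> l" and "l < 1"
    and "\<Phi> = B_mix l \<kappa> c g"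
    and "\<forall>z\<in>unit_disc. deriv \<Phi> z \<noteq> 0 \<and>
           Re (z * deriv (deriv \<Phi>) z / deriv \<Phi> z + 1) > - gamma_const l \<kappa>"
    and "univalent (B_mix l \<kappa> c f)"
    and "B_quot (of_real (\<kappa> + 2)) c f \<in> class_H11 \<inter> class_Q"
  shows "(\<Phi> \<prec>\<^sub>s B_mix l \<kappa> c f \<longrightarrow>
            B_quot (of_real (\<kappa> + 2)) c g \<prec>\<^sub>s B_quot (of_real (\<kappa> + 2)) c f) \<and>
         best_subordinant (\<lambda>u v. u + of_real ((1 - l) / (\<kappa> + 1)) * v) \<Phi>
           (B_quot (of_real (\<kappa> + 2)) c g)"
proof -
  define d where "d = (1 - l) / (\<kappa> + 1)"
  define G where "G = B_quot (of_real (\<kappa> + 2)) c g"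
  define P where "P = B_quot (of_real (\<kappa> + 2)) c f"
  have d: "d > 0" using assms by (simp add: d_def)
  have f: "f holomorphic_on ball 0 1" "deriv f 0 = 1" and g: "g holomorphic_on ball 0 1" "deriv g 0 = 1"
    using assms(1,2) by (auto simp: class_A_def univalent_def)
  have holG: "G holomorphic_on ball 0 1"
    unfolding G_def using assms(4) by (intro B_quot_holomorphic g) simp
  have \<Phi>: "\<Phi> z = G z + of_real d * (z * deriv G z)" if "z \<in> ball 0 1" for z
    unfolding assms(8) G_def d_def by (rule B_mix_eq[OF g assms(4) that])
  \<comment> \<open>The form required by \<open>briot_bouquet_positive\<close> with
    \<open>k = deriv G\<close>, \<open>m = deriv \<Phi>\<close>, \<open>a = 1\<close> and
    \<open>b = d\<close>; its conclusion is then convexity of \<open>G\<close>.\<close>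
  have d\<Phi>: "deriv \<Phi> z = of_real (1 + d) * deriv G z + of_real d * (z * deriv (deriv G) z)"
    if z: "z \<in> ball 0 1" for z
  proof -
    have "((\<lambda>z. G z + of_real d * (z * deriv G z)) has_field_derivative
        of_real (1 + d) * deriv G z + of_real d * (z * deriv (deriv G) z)) (at z)"
      using holomorphic_derivI[OF holG open_ball z]
        holomorphic_derivI[OF holomorphic_deriv[OF holG open_ball] open_ball z]
      by (auto intro!: derivative_eq_intros simp: algebra_simps)
    then have "(\<Phi> has_field_derivative
        of_real (1 + d) * deriv G z + of_real d * (z * deriv (deriv G) z)) (at z)"
      by (rule has_field_derivative_transform_within_open[OF _ open_ball z]) (simp add: \<Phi>)
    then show ?thesis by (rule DERIV_imp_deriv)
  qed
  have conv: "deriv G z \<noteq> 0 \<and> Re (1 + z * deriv (deriv G) z / deriv G z) > 0" if z: "z \<in> ball 0 1" for z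
  proof -
    have h: "deriv \<Phi> u \<noteq> 0" "Re (1 + u * deriv (deriv \<Phi>) u / deriv \<Phi> u) > - gamma_const l \<kappa>"
      if "u \<in> ball 0 1" for u
      using assms(9) that by (auto simp: add.commute)
    show ?thesis
      using briot_bouquet_positive[OF holomorphic_deriv[OF holG open_ball] zero_le_one d d\<Phi>
          h gamma_const_bound[OF assms(7,4), folded d_def] z] by blast
  qed
  interpret convex_map G d
    using holG conv d by unfold_locales auto
  have best: "best_subordinant (\<lambda>u v. u + of_real d * v) \<Phi> G"
    by (rule best_subordinant_G) (simp add: \<Phi> Phi_def)
  have "G \<prec>\<^sub>s P" if sub: "\<Phi> \<prec>\<^sub>s B_mix l \<kappa> c f"
  proof -
    have H: "B_mix l \<kappa> c f z = P z + of_real d * (z * deriv P z)" if "z \<in> ball 0 1" for z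
      unfolding P_def d_def by (rule B_mix_eq[OF f assms(4) that])
    \<comment> \<open>Exceptional points lie on the unit circle, so the injective continuation
      \<open>F\<close> from \<open>class_Q\<close> covers the whole open disc and makes
      \<open>P\<close> univalent.\<close>
    have sub_Q: "ball 0 1 \<subseteq> cball 0 1 - exceptional_set P" by (auto simp: exceptional_set_def)
    have "P \<in> class_Q" using assms(11) by (simp add: P_def)
    then obtain F where F: "\<forall>z\<in>ball 0 1. F z = P z" "inj_on F (cball 0 1 - exceptional_set P)"
      unfolding class_Q_def by auto
    have "inj_on P (ball 0 1)"
    proof (rule inj_onI)
      fix x y assume xy: "x \<in> ball 0 1" "y \<in> ball 0 1" "P x = P y"
      then have "F x = F y" using F(1) by simp
      with inj_onD[OF F(2)] subsetD[OF sub_Q] xy show "x = y" by simp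
    qed
    moreover have "P holomorphic_on ball 0 1"
      using assms(11) by (simp add: class_H11_def P_def)
    ultimately have "univalent P" by (simp add: univalent_def)
    moreover have univ_H: "univalent (\<lambda>z. P z + of_real d * (z * deriv P z))"
    proof -
      have "B_mix l \<kappa> c f holomorphic_on ball 0 1" "inj_on (B_mix l \<kappa> c f) (ball 0 1)"
        using assms(10) by (simp_all add: univalent_def)
      then have "(\<lambda>z. P z + of_real d * (z * deriv P z)) holomorphic_on ball 0 1"
        "inj_on (\<lambda>z. P z + of_real d * (z * deriv P z)) (ball 0 1)"
        by - (rule holomorphic_transform[OF _ H], assumption, assumption,
              rule inj_on_cong[OF H, THEN iffD1], assumption, assumption)
      then show ?thesis by (simp add: univalent_def)
    qed
    \<comment> \<open>\<open>H\<close> holds only inside the disc, so the subordination is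
      transferred through its function \<open>w\<close>, whose values stay in the disc.\<close>
    moreover have "\<Phi> \<prec>\<^sub>s (\<lambda>z. P z + of_real d * (z * deriv P z))"
    proof -
      obtain w where w: "w holomorphic_on ball 0 1"
        "\<forall>z\<in>ball 0 1. norm (w z) \<le> norm z \<and> \<Phi> z = B_mix l \<kappa> c f (w z)"
        using sub unfolding subordinate_def by blast
      have "norm (w z) \<le> norm z \<and> \<Phi> z = P (w z) + of_real d * (w z * deriv P (w z))"
        if z: "z \<in> ball 0 1" for z
      proof -
        have "norm (w z) \<le> norm z" using w(2) z by blast
        moreover from this have "w z \<in> ball 0 1" using z by simp
        ultimately show ?thesis using w(2) z H by simp
      qed
      moreover have "(\<lambda>z. P z + of_real d * (z * deriv P z)) holomorphic_on ball 0 1"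
        using univ_H by (simp add: univalent_def)
      ultimately show ?thesis
        using sub w(1) unfolding subordinate_def by blast
    qed
    \<comment> \<open>Thus \<open>P\<close> is one of the solutions over which subordinants
      quantify, and the first claim follows from \<open>best\<close>.\<close>
    ultimately have "superord_solution (\<lambda>u v. u + of_real d * v) \<Phi> P"
      by (simp add: superord_solution_def)
    then show ?thesis using best unfolding best_subordinant_def subordinant_def by blast
  qed
  with best show ?thesis unfolding G_def P_def d_def by blast
qed

end
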